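(* The $3$-polytopes that are the Cartesian product of two graphs are exactly the Cartesian products of $K_2$ and an outerplanar, $2$-connected graph, and the Cartesian products of a path and a polygon.
   Context: All graphs are finite and simple. The Cartesian product $H\square J$ of graphs $H,J$ has vertex set $V(H)\times V(J)$ and edge set $\{(a,x)(b,y) : (a=b \text{ and } xy\in E(J)) \text{ or } (ab\in E(H) \text{ and } x=y)\}$. For $k\ge 1$, a graph $G$ is $k$-connected if $|V(G)|>k$ and, however one removes fewer than $k$ vertices from $G$, the resulting graph is connected. A graph is planar if it can be drawn in the plane so that no edges cross, except possibly at vertices; it is outerplanar if it has such a drawing with all vertices on the boundary of a single region. A $3$-polytope is a planar, $3$-connected graph. $K_n$, $n\geq 1$, is the complete graph on $n$ vertices; $P_n$, $n\geq 1$, is the simple path on $n$ vertices (and $n-1$ edges). A polygon is a cycle.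
   Formalization: Both factors of the product are required to have at least two vertices, and the path at least two vertices: otherwise K_4 = K_1 □ K_4 would be an unlisted 3-polytope product, and P_1 □ C_m = C_m, which is not 3-connected, would be listed. *)

theory Defs
  imports "HOL-Analysis.Analysis" "Graph_Theory.Graph_Theory"
begin

text \<open>
  Finite simple graphs are \<^locale>\<open>pair_graph\<close>s: an undirected edge between \<open>u\<close> and \<open>v\<close> is
  represented by the two arcs \<open>(u, v)\<close> and \<open>(v, u)\<close>. Both imported libraries have a constant named
  \<open>connected\<close>; the graph-theoretic one is always written qualified.
\<close>

definition cart_prod ::
    "'a pair_pre_digraph \<Rightarrow> 'b pair_pre_digraph \<Rightarrow> ('a \<times> 'b) pair_pre_digraph" (infixr \<open>\<box>\<close> 75) where
  "H \<box> J = \<lparr> pverts = pverts H \<times> pverts J,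
     parcs = {((a, x), (b, y)) | a x b y.
       (a = b \<and> a \<in> pverts H \<and> (x, y) \<in> parcs J) \<or>
       ((a, b) \<in> parcs H \<and> x = y \<and> x \<in> pverts J)} \<rparr>"

definition k_connected :: "nat \<Rightarrow> 'a pair_pre_digraph \<Rightarrow> bool" where
  "k_connected k G \<longleftrightarrow> k < card (pverts G) \<and>
     (\<forall>S \<subseteq> pverts G. card S < k \<longrightarrow>
        Digraph_Component.connected (with_proj G \<restriction> (pverts G - S)))"

text \<open>
  A drawing places the vertices at distinct points of the plane and assigns to every undirected
  edge \<open>{u, v}\<close> a point set \<open>A {u, v}\<close> that is a simple arc joining the two endpoints and meeting
  no further vertex. Distinct edges may meet only at vertices.
\<close>

definition plane_drawing ::
    "'a pair_pre_digraph \<Rightarrow> ('a \<Rightarrow> complex) \<Rightarrow> ('a set \<Rightarrow> complex set) \<Rightarrow> bool" where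
  "plane_drawing G p A \<longleftrightarrow>
     inj_on p (pverts G) \<and>
     (\<forall>(u, v) \<in> parcs G.
        (\<exists>g. arc g \<and> pathstart g = p u \<and> pathfinish g = p v \<and> path_image g = A {u, v}) \<and>
        A {u, v} \<inter> p ` pverts G = {p u, p v}) \<and>
     (\<forall>(u, v) \<in> parcs G. \<forall>(x, y) \<in> parcs G.
        {u, v} \<noteq> {x, y} \<longrightarrow> A {u, v} \<inter> A {x, y} \<subseteq> p ` pverts G)"

definition drawing_points ::
    "'a pair_pre_digraph \<Rightarrow> ('a \<Rightarrow> complex) \<Rightarrow> ('a set \<Rightarrow> complex set) \<Rightarrow> complex set" where
  "drawing_points G p A = p ` pverts G \<union> (\<Union>(u, v) \<in> parcs G. A {u, v})"

definition planar :: "'a pair_pre_digraph \<Rightarrow> bool" where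
  "planar G \<longleftrightarrow> (\<exists>p A. plane_drawing G p A)"

text \<open>The regions of a drawing are the connected components of its complement.\<close>

definition outerplanar :: "'a pair_pre_digraph \<Rightarrow> bool" where
  "outerplanar G \<longleftrightarrow> (\<exists>p A. plane_drawing G p A \<and>
     (\<exists>R \<in> components (- drawing_points G p A). p ` pverts G \<subseteq> frontier R))"

definition three_polytope :: "'a pair_pre_digraph \<Rightarrow> bool" where
  "three_polytope G \<longleftrightarrow> pair_graph G \<and> planar G \<and> k_connected 3 G"

definition graph_iso :: "'a pair_pre_digraph \<Rightarrow> 'b pair_pre_digraph \<Rightarrow> bool" (infix \<open>\<simeq>\<^sub>G\<close> 50) where
  "G \<simeq>\<^sub>G H \<longleftrightarrow> digraph_iso (with_proj G) (with_proj H)"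

definition path_graph :: "nat \<Rightarrow> nat pair_pre_digraph" where
  "path_graph n = \<lparr> pverts = {..<n},
     parcs = {(i, j). i < n \<and> j < n \<and> (j = Suc i \<or> i = Suc j)} \<rparr>"

text \<open>This is the polygon with \<open>n\<close> vertices only for \<open>n \<ge> 3\<close>.\<close>

definition cycle_graph :: "nat \<Rightarrow> nat pair_pre_digraph" where
  "cycle_graph n = \<lparr> pverts = {..<n},
     parcs = {(i, j). i < n \<and> j < n \<and> (j = Suc i mod n \<or> i = Suc j mod n)} \<rparr>"

lemma pair_graph_cart_prod:
  assumes "pair_graph H" "pair_graph J"
  shows "pair_graph (H \<box> J)"
proof -
  interpret H: pair_graph H by fact
  interpret J: pair_graph J by fact
  have arcs: "parcs (H \<box> J) \<subseteq> (pverts H \<times> pverts J) \<times> (pverts H \<times> pverts J)"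
    by (auto simp: cart_prod_def dest: H.wellformed' J.wellformed')
  have symH: "(b, a) \<in> parcs H" if "(a, b) \<in> parcs H" for a b
    using H.pair_sym_arcs that by (auto simp: symmetric_def dest: symD)
  have symJ: "(b, a) \<in> parcs J" if "(a, b) \<in> parcs J" for a b
    using J.pair_sym_arcs that by (auto simp: symmetric_def dest: symD)
  have "symmetric (with_proj (H \<box> J))"
    by (auto simp: symmetric_def cart_prod_def intro!: symI dest: symH symJ)
  moreover have "finite (parcs (H \<box> J))"
    using arcs by (rule finite_subset) (simp add: H.pair_finite_verts J.pair_finite_verts)
  ultimately show ?thesis
    using arcs H.pair_finite_verts J.pair_finite_verts
    by unfold_locales
      (auto simp: cart_prod_def dest: H.pair_no_loops J.pair_no_loops H.wellformed' J.wellformed')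
qed

lemma pair_graph_path_graph: "pair_graph (path_graph n)"
proof -
  have "finite (parcs (path_graph n))"
    by (rule finite_subset[of _ "{..<n} \<times> {..<n}"]) (auto simp: path_graph_def)
  then show ?thesis
    by unfold_locales (auto simp: path_graph_def symmetric_def intro!: symI)
qed

lemma pair_graph_cycle_graph:
  assumes "n \<ge> 3"
  shows "pair_graph (cycle_graph n)"
proof -
  have "finite (parcs (cycle_graph n))"
    by (rule finite_subset[of _ "{..<n} \<times> {..<n}"]) (auto simp: cycle_graph_def)
  moreover have "Suc i mod n \<noteq> i \<and> i \<noteq> Suc i mod n" if "i < n" for i
    using assms that by (cases "Suc i = n") auto
  ultimately show ?thesis
    by unfold_locales (auto simp: cycle_graph_def symmetric_def intro!: symI)
qed

lemma graph_iso_iff: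
  assumes "pair_graph G" "pair_graph H"
  shows "G \<simeq>\<^sub>G H \<longleftrightarrow> (\<exists>f. bij_betw f (pverts G) (pverts H) \<and>
    (\<forall>u \<in> pverts G. \<forall>v \<in> pverts G. (u, v) \<in> parcs G \<longleftrightarrow> (f u, f v) \<in> parcs H))"
proof
  interpret G: pair_graph G by fact
  interpret H: pair_graph H by fact
  { assume "G \<simeq>\<^sub>G H"
    then obtain h where h: "G.digraph_isomorphism h" "with_proj H = app_iso h (with_proj G)"
      by (auto simp: graph_iso_def digraph_iso_def)
    let ?f = "iso_verts h"
    have V: "pverts H = ?f ` pverts G" "parcs H = iso_arcs h ` parcs G"
      "iso_tail h = fst" "iso_head h = snd"
      using arg_cong[OF h(2), of verts] arg_cong[OF h(2), of arcs]
        arg_cong[OF h(2), of tail] arg_cong[OF h(2), of head]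
      by (simp_all add: app_iso_def)
    have inj: "inj_on ?f (pverts G)"
      using h(1) by (simp add: G.digraph_isomorphism_def)
    have ar: "iso_arcs h a = (?f (fst a), ?f (snd a))" if "a \<in> parcs G" for a
      using h(1) that V(3,4) by (auto simp: G.digraph_isomorphism_def prod_eq_iff)
    have "(u, v) \<in> parcs G \<longleftrightarrow> (?f u, ?f v) \<in> parcs H" if "u \<in> pverts G" "v \<in> pverts G" for u v
    proof
      assume "(u, v) \<in> parcs G"
      then show "(?f u, ?f v) \<in> parcs H" using ar V(2) by force
    next
      assume "(?f u, ?f v) \<in> parcs H"
      then obtain a where a: "a \<in> parcs G" "(?f u, ?f v) = iso_arcs h a" using V(2) by auto
      then have "?f u = ?f (fst a)" "?f v = ?f (snd a)" using ar by auto
      moreover have "fst a \<in> pverts G" "snd a \<in> pverts G"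
        using a(1) G.arc_fst_in_verts G.arc_snd_in_verts by auto
      ultimately have "u = fst a" "v = snd a" using inj that by (auto dest: inj_onD)
      then show "(u, v) \<in> parcs G" using a(1) by simp
    qed
    then show "\<exists>f. bij_betw f (pverts G) (pverts H) \<and>
      (\<forall>u \<in> pverts G. \<forall>v \<in> pverts G. (u, v) \<in> parcs G \<longleftrightarrow> (f u, f v) \<in> parcs H)"
      using inj V(1) by (auto simp: bij_betw_def intro!: exI[of _ ?f]) }
  { assume "\<exists>f. bij_betw f (pverts G) (pverts H) \<and>
      (\<forall>u \<in> pverts G. \<forall>v \<in> pverts G. (u, v) \<in> parcs G \<longleftrightarrow> (f u, f v) \<in> parcs H)"
    then obtain f where f: "bij_betw f (pverts G) (pverts H)"
      "\<And>u v. u \<in> pverts G \<Longrightarrow> v \<in> pverts G \<Longrightarrow> (u, v) \<in> parcs G \<longleftrightarrow> (f u, f v) \<in> parcs H" by blast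
    have inj: "inj_on f (pverts G)" and im: "f ` pverts G = pverts H"
      using f(1) by (auto simp: bij_betw_def)
    define h where "h = \<lparr> iso_verts = f, iso_arcs = map_prod f f, iso_head = snd, iso_tail = fst \<rparr>"
    have "inj_on (map_prod f f) (parcs G)"
      by (rule inj_on_subset[OF map_prod_inj_on[OF inj inj]]) (auto dest: G.wellformed')
    then have "G.digraph_isomorphism h"
      using inj by (auto simp: G.digraph_isomorphism_def h_def G.wf_digraph)
    moreover have "parcs H = map_prod f f ` parcs G"
    proof (intro equalityI subsetI)
      fix e assume e: "e \<in> parcs H"
      obtain x y where xy: "e = (x, y)" by (cases e)
      then have "x \<in> f ` pverts G" "y \<in> f ` pverts G" using e im H.wellformed' by auto
      then obtain u v where "u \<in> pverts G" "x = f u" "v \<in> pverts G" "y = f v" by auto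
      then show "e \<in> map_prod f f ` parcs G" using f(2) e xy by force
    next
      fix e assume "e \<in> map_prod f f ` parcs G"
      then show "e \<in> parcs H" using f(2) by (auto dest: G.wellformed')
    qed
    then have "with_proj H = app_iso h (with_proj G)"
      using im by (simp add: with_proj_def app_iso_def h_def)
    ultimately show "G \<simeq>\<^sub>G H" unfolding graph_iso_def digraph_iso_def by blast }
qed

end

theory Submission
  imports Defs
begin

text \<open>
  Topologically everything rests on one property of theta curves: a connected set that avoids three
  arcs with common endpoints cannot accumulate at an inner point of each of them. Applied to the
  drawing of a connected subgraph it excludes subdivisions of \<open>K\<^bsub>3,3\<^esub>\<close>, and hence the products of a
  claw with a path of length two and of two cycles. So if both factors of a 3-polytope have at least
  three vertices, both have maximum degree two, and the minimum degree of the product leaves only a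
  path and a cycle. If one factor is \<open>K\<^sub>2\<close>, the second copy of the other factor \<open>J\<close> lies in one region of
  the drawing of the first copy and touches all its vertices, so \<open>J\<close> is outerplanar. Conversely, applied
  to the outer region of a 2-connected outerplanar graph, the property shows that a longest cycle is
  Hamiltonian and that no two chords cross. The graph then embeds with its vertices on a line and
  its edges above it, and the product with \<open>K\<^sub>2\<close> is drawn by reflecting this picture.
\<close>

section \<open>Theta curves\<close>

text \<open>Nothing is derived from counting faces: each obstruction is a connected set
  \<open>S\<close> in the complement of a theta curve. The sharp form \<open>arcs_separated\<close>
  says that if \<open>S\<close> accumulates at inner points of the two outer arcs, then their union
  separates \<open>S\<close> from the inner points of the middle arc. Accumulation on the middle arc
  is not assumed, so the statement also applies to a chord, whose arc carries no inner vertex; with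
  accumulation on all three arcs it turns into a contradiction. The set \<open>S\<close> varies: a
  neighbourhood of a connected vertex set for \<open>K_{3,3}\<close>, the outer region for
  outerplanar graphs, an open chord for crossing chords. The obstacle in the converse direction is
  that the arcs of an outerplanar drawing can be arbitrarily wild. Only the order of the vertices is
  kept from it, and the prism is drawn afresh from that order.\<close>

lemma simple_closed_curve_of_two_arcs:
  fixes g h :: "real \<Rightarrow> complex"
  assumes "arc g" "arc h" "pathstart g = a" "pathfinish g = b" "pathstart h = a" "pathfinish h = b"
    and "path_image g \<inter> path_image h = {a, b}"
  obtains c where "simple_path c" "pathfinish c = pathstart c"
    "path_image c = path_image g \<union> path_image h"
proof
  show "simple_path (g +++ reversepath h)"
    using assms by (auto simp: simple_path_join_loop_eq arc_simple_path simple_path_reversepath)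
qed (use assms in \<open>auto simp: path_image_join\<close>)

lemma insideI_not_outside: "p \<notin> X \<Longrightarrow> p \<notin> outside X \<Longrightarrow> p \<in> inside X"
  by (metis ComplI UnE inside_Un_outside)

lemma connected_subset_inside:
  fixes X :: "'a::{real_normed_vector, perfect_space} set"
  assumes "Topological_Spaces.connected T" "T \<inter> X = {}" "s \<in> T" "s \<in> inside X"
  shows "T \<subseteq> inside X"
proof
  fix t assume "t \<in> T"
  have "connected_component (-X) s t"
    unfolding connected_component_def using assms \<open>t \<in> T\<close> by (intro exI[of _ T]) auto
  then show "t \<in> inside X" using assms inside_same_component by blast
qed

lemma connected_subset_outside:
  fixes X :: "'a::{real_normed_vector, perfect_space} set"
  assumes "Topological_Spaces.connected T" "T \<inter> X = {}" "s \<in> T" "s \<in> outside X"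
  shows "T \<subseteq> outside X"
proof
  fix t assume "t \<in> T"
  have "connected_component (-X) s t"
    unfolding connected_component_def using assms \<open>t \<in> T\<close> by (intro exI[of _ T]) auto
  then show "t \<in> outside X" using assms outside_same_component by blast
qed

text \<open>The three arcs are interchangeable. Facts are proved for one distribution of roles, and
  the other cases come from interpreting the locale again with the arcs permuted.\<close>

locale theta_curve =
  fixes g1 g2 g3 :: "real \<Rightarrow> complex" and a b :: complex
  assumes arcs: "arc g1" "arc g2" "arc g3"
    and ends: "pathstart g1 = a" "pathfinish g1 = b" "pathstart g2 = a" "pathfinish g2 = b"
      "pathstart g3 = a" "pathfinish g3 = b"
    and meets: "path_image g1 \<inter> path_image g2 = {a, b}" "path_image g1 \<inter> path_image g3 = {a, b}"
      "path_image g2 \<inter> path_image g3 = {a, b}"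
begin

lemma swap13: "theta_curve g3 g2 g1 a b"
  using arcs ends meets by unfold_locales auto

abbreviation "c1 \<equiv> path_image g1"
abbreviation "c2 \<equiv> path_image g2"
abbreviation "c3 \<equiv> path_image g3"

lemma closed_arcs: "closed c1" "closed c2" "closed c3"
  using arcs by (auto intro: closed_path_image arc_imp_path)

lemma compact_arcs: "compact c1" "compact c2" "compact c3"
  using arcs by (auto intro: compact_path_image arc_imp_path)

lemma a_neq_b: "a \<noteq> b"
  using arcs ends arc_distinct_ends by metis

lemma endless: "Topological_Spaces.connected (c1 - {a, b})" "Topological_Spaces.connected (c2 - {a, b})" "Topological_Spaces.connected (c3 - {a, b})"
  "c1 - {a, b} \<noteq> {}" "c2 - {a, b} \<noteq> {}" "c3 - {a, b} \<noteq> {}"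
  using arcs ends by (metis arc_imp_simple_path connected_simple_path_endless,
      metis arc_imp_simple_path connected_simple_path_endless,
      metis arc_imp_simple_path connected_simple_path_endless,
      metis arc_imp_simple_path nonempty_simple_path_endless,
      metis arc_imp_simple_path nonempty_simple_path_endless,
      metis arc_imp_simple_path nonempty_simple_path_endless)

lemma jordan12:
  "inside (c1 \<union> c2) \<noteq> {}" "Topological_Spaces.connected (inside (c1 \<union> c2))" "Topological_Spaces.connected (outside (c1 \<union> c2))"
  "frontier (inside (c1 \<union> c2)) = c1 \<union> c2"
proof -
  obtain c where "simple_path c" "pathfinish c = pathstart c" "path_image c = c1 \<union> c2"
    using simple_closed_curve_of_two_arcs arcs ends meets by metis
  then show "inside (c1 \<union> c2) \<noteq> {}" "Topological_Spaces.connected (inside (c1 \<union> c2))" "Topological_Spaces.connected (outside (c1 \<union> c2))"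
    "frontier (inside (c1 \<union> c2)) = c1 \<union> c2"
    using Jordan_inside_outside by metis+
qed

lemma split12:
  assumes "c3 \<inter> inside (c1 \<union> c2) \<noteq> {}"
  shows "inside (c1 \<union> c3) \<inter> inside (c2 \<union> c3) = {}"
    "inside (c1 \<union> c3) \<union> inside (c2 \<union> c3) \<union> (c3 - {a, b}) = inside (c1 \<union> c2)"
  using split_inside_simple_closed_curve[of g1 a b g2 g3] arcs ends meets a_neq_b assms
  by (auto simp: arc_imp_simple_path)

lemma bounded_inside12: "bounded (inside (c1 \<union> c2))"
  using compact_arcs bounded_inside compact_imp_bounded bounded_Un by metis

end

text \<open>Otherwise an inner point of \<open>c1 \<union> c2\<close> and a far away point lie outside \<open>c1 \<union> c3\<close> and outside
  \<open>c2 \<union> c3\<close>, so Janiszewski's theorem would join them off the whole theta curve.\<close>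

lemma (in theta_curve) some_arc_inside:
  "c3 \<inter> inside (c1 \<union> c2) \<noteq> {} \<or> c2 \<inter> inside (c1 \<union> c3) \<noteq> {} \<or> c1 \<inter> inside (c2 \<union> c3) \<noteq> {}"
proof (rule ccontr)
  assume "\<not> ?thesis"
  then have no3: "c3 \<inter> inside (c1 \<union> c2) = {}" and no2: "c2 \<inter> inside (c1 \<union> c3) = {}"
    and no1: "c1 \<inter> inside (c2 \<union> c3) = {}" by auto
  interpret t132: theta_curve g1 g3 g2 a b using arcs ends meets by unfold_locales auto
  interpret t231: theta_curve g2 g3 g1 a b using arcs ends meets by unfold_locales auto
  obtain p where p: "p \<in> inside (c1 \<union> c2)" using jordan12 by auto
  have dis: "inside (c1 \<union> c2) \<inter> (c1 \<union> c2 \<union> c3) = {}"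
    using no3 inside_no_overlap by blast
  have fr: "c1 \<union> c2 \<subseteq> closure (inside (c1 \<union> c2))"
    using jordan12(4) by (auto simp: frontier_def)
  \<comment> \<open>If \<open>p\<close> were inside \<open>c1 \<union> c3\<close>, then so would be
    the whole inside of \<open>c1 \<union> c2\<close>, which avoids all three arcs. Its frontier
    contains \<open>c2\<close>, so the inner points of \<open>c2\<close> would lie inside
    \<open>c1 \<union> c3\<close> too, against \<open>no2\<close>.\<close>
  have p13: "p \<in> outside (c1 \<union> c3)"
  proof (rule ccontr)
    assume "p \<notin> outside (c1 \<union> c3)"
    then have "p \<in> inside (c1 \<union> c3)" using dis p by (intro insideI_not_outside) auto
    then have "inside (c1 \<union> c2) \<subseteq> inside (c1 \<union> c3)"
      by (intro connected_subset_inside[OF jordan12(2) _ p]) (use dis in auto)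
    then have "c2 \<subseteq> closure (inside (c1 \<union> c3))" using fr closure_mono by blast
    also have "\<dots> \<subseteq> c1 \<union> c3 \<union> inside (c1 \<union> c3)"
      by (rule closure_inside_subset) (auto simp: closed_arcs)
    finally have "c2 - {a, b} \<subseteq> inside (c1 \<union> c3)" using meets by blast
    then show False using no2 endless(5) by blast
  qed
  have p23: "p \<in> outside (c2 \<union> c3)"
  proof (rule ccontr)
    assume "p \<notin> outside (c2 \<union> c3)"
    then have "p \<in> inside (c2 \<union> c3)" using dis p by (intro insideI_not_outside) auto
    then have "inside (c1 \<union> c2) \<subseteq> inside (c2 \<union> c3)"
      by (intro connected_subset_inside[OF jordan12(2) _ p]) (use dis in auto)
    then have "c1 \<subseteq> closure (inside (c2 \<union> c3))" using fr closure_mono by blast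
    also have "\<dots> \<subseteq> c2 \<union> c3 \<union> inside (c2 \<union> c3)"
      by (rule closure_inside_subset) (auto simp: closed_arcs)
    finally have "c1 - {a, b} \<subseteq> inside (c2 \<union> c3)" using meets by blast
    then show False using no1 endless(4) by blast
  qed
  have "bounded (c1 \<union> c2 \<union> c3 \<union> inside (c1 \<union> c2) \<union> inside (c1 \<union> c3) \<union> inside (c2 \<union> c3))"
    using compact_arcs bounded_inside12 t132.bounded_inside12 t231.bounded_inside12
    by (auto intro: compact_imp_bounded)
  then obtain q where q: "q \<notin> c1 \<union> c2 \<union> c3 \<union> inside (c1 \<union> c2) \<union> inside (c1 \<union> c3) \<union> inside (c2 \<union> c3)"
    using not_bounded_UNIV by (metis UNIV_eq_I)
  have q13: "q \<in> outside (c1 \<union> c3)" "q \<in> outside (c2 \<union> c3)"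
    using q by (blast intro: ccontr[of "_ \<in> _"] insideI_not_outside)+
  have "connected_component (- (c1 \<union> c3)) p q"
    unfolding connected_component_def using t132.jordan12(3) p13 q13 outside_no_overlap
    by (intro exI[of _ "outside (c1 \<union> c3)"]) blast
  moreover have "connected_component (- (c2 \<union> c3)) p q"
    unfolding connected_component_def using t231.jordan12(3) p23 q13 outside_no_overlap
    by (intro exI[of _ "outside (c2 \<union> c3)"]) blast
  \<comment> \<open>Janiszewski's theorem asks for a connected intersection of the two closed
    curves; here it is the common arc.\<close>
  moreover have "(c1 \<union> c3) \<inter> (c2 \<union> c3) = c3" using meets by auto
  moreover have "compact (c1 \<union> c3)" "closed (c2 \<union> c3)" "Topological_Spaces.connected c3"
    using compact_arcs closed_arcs arcs by (auto intro: connected_path_image arc_imp_path)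
  ultimately have "connected_component (- ((c1 \<union> c3) \<union> (c2 \<union> c3))) p q"
    by (intro Janiszewski[of "c1 \<union> c3" "c2 \<union> c3" p q]) (simp_all only:)
  then have "connected_component (- (c1 \<union> c2)) p q"
    by (rule connected_component_of_subset) auto
  then have "q \<in> inside (c1 \<union> c2)" using p inside_same_component by blast
  then show False using q by blast
qed

text \<open>By \<open>some_arc_inside\<close> one arc runs inside the closed curve of the other two
  and splits that inside into two parts. If it is \<open>c2\<close> and \<open>S\<close> lies on the
  side of \<open>z\<close>, then \<open>S\<close> is confined to one part, whose closure misses the
  inner points of \<open>c1\<close> or of \<open>c3\<close>. If it is \<open>c1\<close> or
  \<open>c3\<close>, accumulation on it forces \<open>S\<close> into one of the parts: one does not
  reach the other outer arc, and the other is the inside of \<open>c1 \<union> c3\<close>, where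
  \<open>z\<close> cannot be.\<close>

lemma (in theta_curve) arcs_separated:
  assumes S: "Topological_Spaces.connected S" "S \<inter> (c1 \<union> c2 \<union> c3) = {}" "s \<in> S"
    and x: "x \<in> closure S" "x \<in> c1 - {a, b}" and y: "y \<in> closure S" "y \<in> c3 - {a, b}"
    and z: "z \<in> c2 - {a, b}"
  shows "\<not> connected_component (- (c1 \<union> c3)) s z"
proof
  assume con: "connected_component (- (c1 \<union> c3)) s z"
  note no = inside_no_overlap[of "c1 \<union> c2"] inside_no_overlap[of "c1 \<union> c3"] inside_no_overlap[of "c2 \<union> c3"]
  \<comment> \<open>A set inside \<open>h1 \<union> h2\<close> cannot accumulate at inner points of
    \<open>h3\<close> when \<open>h3\<close> stays out of that inside.\<close>
  have *: False
    if "theta_curve h1 h2 h3 a b" "closure S \<inter> (path_image h3 - {a, b}) \<noteq> {}"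
      "S \<inter> (path_image h1 \<union> path_image h2 \<union> path_image h3) = {}"
      "s \<in> inside (path_image h1 \<union> path_image h2)" "path_image h3 \<inter> inside (path_image h1 \<union> path_image h2) = {}"
    for h1 h2 h3
  proof -
    interpret t: theta_curve h1 h2 h3 a b by fact
    have "S \<subseteq> inside (t.c1 \<union> t.c2)"
      using connected_subset_inside[OF S(1) _ S(3) that(4)] that(3) by blast
    then have "closure S \<subseteq> closure (inside (t.c1 \<union> t.c2))" by (rule closure_mono)
    also have "\<dots> \<subseteq> t.c1 \<union> t.c2 \<union> inside (t.c1 \<union> t.c2)"
      by (rule closure_inside_subset) (auto simp: t.closed_arcs)
    finally show False using that(2,5) t.meets by blast
  qed
  \<comment> \<open>\<open>h1\<close> is whichever of \<open>g1\<close> and \<open>g3\<close> enters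
    the inside of the curve formed by \<open>g2\<close> and the other one.\<close>
  have **: False
    if "theta_curve h1 h2 h3 a b" "path_image h1 \<union> path_image h3 = c1 \<union> c3" "path_image h2 = c2"
      "h1 = g1 \<and> h3 = g3 \<or> h1 = g3 \<and> h3 = g1" "path_image h1 \<inter> inside (path_image h2 \<union> path_image h3) \<noteq> {}"
    for h1 h2 h3
  proof -
    interpret t: theta_curve h1 h2 h3 a b by fact
    interpret t': theta_curve h2 h3 h1 a b using t.arcs t.ends t.meets by unfold_locales auto
    have sub: "inside (t.c1 \<union> t.c2) \<union> inside (t.c1 \<union> t.c3) \<union> (t.c1 - {a, b}) = inside (t.c2 \<union> t.c3)"
      using t'.split12(2)[OF that(5)] by (simp add: Un_commute)
    have dis: "S \<inter> (t.c1 \<union> t.c2 \<union> t.c3) = {}" using S(2) that by blast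
    have cl: "closure S \<inter> (t.c1 - {a, b}) \<noteq> {}" "closure S \<inter> (t.c3 - {a, b}) \<noteq> {}"
      using x y that(4) by blast+
    show False
    proof (cases "s \<in> inside (t.c2 \<union> t.c3)")
      case True
      then consider "s \<in> inside (t.c1 \<union> t.c2)" | "s \<in> inside (t.c1 \<union> t.c3)" using sub dis S(3) by blast
      then show False
      proof cases
        case 1
        show False
          by (rule *[OF that(1) cl(2) dis 1]) (use sub inside_no_overlap[of "t.c2 \<union> t.c3"] in blast)
      next
        case 2
        then have "z \<in> inside (t.c1 \<union> t.c3)" using con that(2) inside_same_component by metis
        then show False using sub z that(3) inside_no_overlap[of "t.c2 \<union> t.c3"] by blast
      qed
    next
      case False
      then have "s \<in> outside (t.c2 \<union> t.c3)"
        using dis S(3) inside_Un_outside[of "t.c2 \<union> t.c3"] by blast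
      then have "S \<subseteq> outside (t.c2 \<union> t.c3)"
        by (intro connected_subset_outside[OF S(1) _ S(3)]) (use dis in auto)
      then have "closure S \<subseteq> closure (outside (t.c2 \<union> t.c3))" by (rule closure_mono)
      also have "\<dots> \<subseteq> t.c2 \<union> t.c3 \<union> outside (t.c2 \<union> t.c3)"
        by (rule closure_outside_subset) (auto simp: t.closed_arcs)
      finally obtain w where "w \<in> t.c1 - {a, b}" "w \<in> t.c2 \<union> t.c3 \<union> outside (t.c2 \<union> t.c3)"
        using cl(1) by blast
      moreover from this(1) have "w \<in> inside (t.c2 \<union> t.c3)" using sub by blast
      ultimately show False
        using inside_Int_outside[of "t.c2 \<union> t.c3"] inside_no_overlap[of "t.c2 \<union> t.c3"] by blast
    qed
  qed
  consider "c2 \<inter> inside (c1 \<union> c3) \<noteq> {}" | "c1 \<inter> inside (c2 \<union> c3) \<noteq> {}"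
    | "c3 \<inter> inside (c1 \<union> c2) \<noteq> {}" using some_arc_inside by blast
  then show False
  proof cases
    case 1
    interpret t: theta_curve g1 g3 g2 a b using arcs ends meets by unfold_locales auto
    have sub: "inside (c1 \<union> c2) \<union> inside (c3 \<union> c2) \<union> (c2 - {a, b}) = inside (c1 \<union> c3)"
      using t.split12(2)[OF 1] .
    then have "z \<in> inside (c1 \<union> c3)" using z by blast
    then have "s \<in> inside (c1 \<union> c3)" using con inside_same_component connected_component_sym by metis
    then consider "s \<in> inside (c1 \<union> c2)" | "s \<in> inside (c3 \<union> c2)" using sub S by blast
    then show False
    proof cases
      case 1
      show False
        by (rule *[OF theta_curve_axioms _ S(2) 1]) (use y sub no in blast)+
    next
      case 2
      interpret u: theta_curve g3 g2 g1 a b by (rule swap13)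
      show False
        by (rule *[OF u.theta_curve_axioms _ _ 2]) (use x S(2) sub no in blast)+
    qed
  next
    case 2
    show False by (rule **[OF theta_curve_axioms _ _ _ 2]) auto
  next
    case 3
    show False by (rule **[OF swap13]) (use 3 in \<open>auto simp: Un_commute\<close>)
  qed
qed

section \<open>Paths and connected vertex sets in a drawing\<close>

text \<open>Only the inner vertices are listed: internal disjointness of paths becomes disjointness
  of sets, and a single edge is the case of an empty list.\<close>

definition ipath :: "('a \<times> 'a) set \<Rightarrow> 'a \<Rightarrow> 'a list \<Rightarrow> 'a \<Rightarrow> bool" where
  "ipath E a xs b \<longleftrightarrow>
     distinct (a # xs @ [b]) \<and> successively (\<lambda>u v. (u, v) \<in> E) (a # xs @ [b])"

text \<open>Reachability inside \<open>W\<close> in a bare relation, so that vertex deletions and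
  images can be handled without digraph records; \<open>connected_induce_subgraph_iff\<close> links
  it to the connectivity of induced subgraphs.\<close>

definition connected_in :: "('a \<times> 'a) set \<Rightarrow> 'a set \<Rightarrow> bool" where
  "connected_in E W \<longleftrightarrow> W \<noteq> {} \<and> (\<forall>u \<in> W. \<forall>v \<in> W. (u, v) \<in> (E \<inter> W \<times> W)\<^sup>*)"

text \<open>A list of one vertex yields the empty set and not the point of that vertex. Since edges
  are unordered pairs, reversing the list does not change the set.\<close>

definition walk_points :: "('a set \<Rightarrow> complex set) \<Rightarrow> 'a list \<Rightarrow> complex set" where
  "walk_points A xs = (\<Union>i\<in>{i. Suc i < length xs}. A {xs ! i, xs ! Suc i})"

lemma walk_points_Cons2: "walk_points A (u # v # vs) = A {u, v} \<union> walk_points A (v # vs)"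
proof -
  have "{i. Suc i < length (u # v # vs)} = insert 0 (Suc ` {i. Suc i < length (v # vs)})"
    by (auto simp: image_iff) (metis Suc_less_eq not0_implies_Suc)
  then show ?thesis by (simp add: walk_points_def)
qed

lemma walk_points_single [simp]: "walk_points A [u] = {}"
  by (simp add: walk_points_def)

lemma walk_points_pair [simp]: "walk_points A [u, v] = A {u, v}"
  by (simp add: walk_points_Cons2)

lemma successively_nth:
  "successively P xs \<Longrightarrow> Suc i < length xs \<Longrightarrow> P (xs ! i) (xs ! Suc i)"
  by (simp add: successively_conv_nth)

text \<open>The ends occupy the first and the last position of a distinct list, so they are
  consecutive only if nothing lies between. This matters when the edge between \<open>a\<close> and
  \<open>b\<close> is itself one of the competing paths.\<close>

lemma ipath_no_shortcut:
  assumes "ipath E a xs b" "xs \<noteq> []" "Suc i < length (a # xs @ [b])"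
  shows "{(a # xs @ [b]) ! i, (a # xs @ [b]) ! Suc i} \<noteq> {a, b}"
proof
  let ?l = "a # xs @ [b]"
  assume eq: "{?l ! i, ?l ! Suc i} = {a, b}"
  have d: "distinct ?l" using assms by (simp add: ipath_def)
  have a: "a = ?l ! 0" and b: "b = ?l ! (length ?l - 1)" by (simp_all add: nth_append)
  have "?l ! i = a \<and> ?l ! Suc i = b \<or> ?l ! i = b \<and> ?l ! Suc i = a"
    using eq by (auto simp: doubleton_eq_iff)
  then show False
  proof
    assume "?l ! i = a \<and> ?l ! Suc i = b"
    then have "?l ! i = ?l ! 0" "?l ! Suc i = ?l ! (length ?l - 1)" using a b by auto
    then have "i = 0" "Suc i = length ?l - 1"
      using nth_eq_iff_index_eq[OF d] assms(3) by (metis Suc_lessD length_greater_0_conv list.distinct(1),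
          metis assms(3) diff_less length_greater_0_conv list.distinct(1) zero_less_one)
    then show False using assms(2) by simp
  next
    assume "?l ! i = b \<and> ?l ! Suc i = a"
    then have "?l ! Suc i = ?l ! 0" using a by auto
    then show False using nth_eq_iff_index_eq[OF d] assms(3) by fastforce
  qed
qed

lemma connected_arc_minus_end:
  assumes "arc g"
  shows "Topological_Spaces.connected (path_image g - {pathfinish g})"
proof -
  have inj: "inj_on g {0..1}" and cont: "continuous_on {0..1} g"
    using assms by (auto simp: arc_def path_def)
  have "{0..1::real} - {1} = {0..<1}" by auto
  then have "path_image g - {pathfinish g} = g ` {0..<1}"
    using inj_on_image_set_diff[OF inj, of "{0..1}" "{1}"] by (auto simp: path_image_def pathfinish_def)
  moreover have "Topological_Spaces.connected (g ` {0..<1})"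
    by (intro connected_continuous_image continuous_on_subset[OF cont]) auto
  ultimately show ?thesis by simp
qed

lemma arc_end_in_closure:
  fixes g :: "real \<Rightarrow> 'a::metric_space"
  assumes "arc g"
  shows "pathfinish g \<in> closure (path_image g - {pathfinish g})"
proof -
  have "Topological_Spaces.connected (path_image g)"
    using assms by (simp add: arc_imp_path connected_path_image)
  moreover have "pathstart g \<noteq> pathfinish g" using arc_distinct_ends[OF assms] by simp
  then have "path_image g \<noteq> {x}" for x
    by (metis pathfinish_in_path_image pathstart_in_path_image singletonD)
  ultimately have "pathfinish g islimpt path_image g"
    by (intro connected_imp_perfect[of "path_image g"]) (simp_all add: pathfinish_in_path_image)
  then show ?thesis by (simp add: islimpt_in_closure)
qed

lemma pair_graph_edge:
  assumes "pair_graph G" "(u, v) \<in> parcs G"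
  shows "u \<in> pverts G" "v \<in> pverts G" "u \<noteq> v" "(v, u) \<in> parcs G"
proof -
  interpret pair_graph G by fact
  show "u \<in> pverts G" "v \<in> pverts G" "u \<noteq> v" "(v, u) \<in> parcs G"
    using wellformed' assms(2) no_loops pair_sym_arcs
    by (auto simp: symmetric_def dest: symD pair_no_loops)
qed

locale drawn_graph =
  fixes G :: "'a pair_pre_digraph" and p :: "'a \<Rightarrow> complex" and A :: "'a set \<Rightarrow> complex set"
  assumes pair_graph: "pair_graph G" and drawing: "plane_drawing G p A"
begin

abbreviation "V \<equiv> pverts G"
abbreviation "E \<equiv> parcs G"

lemma inj_p: "inj_on p V"
  using drawing by (simp add: plane_drawing_def)

lemma edge_verts: "(u, v) \<in> E \<Longrightarrow> u \<in> V \<and> v \<in> V \<and> u \<noteq> v"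
  using pair_graph_edge[OF pair_graph] by blast

lemma edge_sym: "(u, v) \<in> E \<Longrightarrow> (v, u) \<in> E"
  using pair_graph_edge[OF pair_graph] by blast

lemma edge_arc:
  assumes "(u, v) \<in> E"
  obtains g where "arc g" "pathstart g = p u" "pathfinish g = p v" "path_image g = A {u, v}"
  using drawing assms by (auto simp: plane_drawing_def)

lemma edge_vertex: "(u, v) \<in> E \<Longrightarrow> w \<in> V \<Longrightarrow> p w \<in> A {u, v} \<longleftrightarrow> w \<in> {u, v}"
proof -
  assume uv: "(u, v) \<in> E" and w: "w \<in> V"
  have "A {u, v} \<inter> p ` V = {p u, p v}" using drawing uv unfolding plane_drawing_def by fast
  then have "p w \<in> A {u, v} \<longleftrightarrow> p w = p u \<or> p w = p v" using w by blast
  then show ?thesis using inj_p w edge_verts[OF uv] by (auto dest: inj_onD)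
qed

lemma edges_meet:
  assumes "(u, v) \<in> E" "(x, y) \<in> E" "{u, v} \<noteq> {x, y}" "z \<in> A {u, v}" "z \<in> A {x, y}"
  obtains w where "w \<in> {u, v}" "w \<in> {x, y}" "z = p w"
proof -
  have "A {u, v} \<inter> A {x, y} \<subseteq> p ` V"
    using drawing assms(1-3) unfolding plane_drawing_def by blast
  then obtain w where "w \<in> V" "z = p w" using assms(4,5) by auto
  then show ?thesis using that edge_vertex assms by metis
qed

lemma walk_edge:
  assumes "successively (\<lambda>u v. (u, v) \<in> E) xs" "z \<in> walk_points A xs"
  obtains x y where "(x, y) \<in> E" "z \<in> A {x, y}" "x \<in> set xs" "y \<in> set xs"
  using assms by (auto simp: walk_points_def dest: successively_nth)

lemma ipath_edge:
  assumes "ipath E a xs b" "z \<in> walk_points A (a # xs @ [b])"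
  obtains x y where "(x, y) \<in> E" "z \<in> A {x, y}" "x \<in> set (a # xs @ [b])" "y \<in> set (a # xs @ [b])"
    "xs \<noteq> [] \<Longrightarrow> {x, y} \<noteq> {a, b}"
proof -
  let ?l = "a # xs @ [b]"
  obtain i where i: "Suc i < length ?l" "z \<in> A {?l ! i, ?l ! Suc i}"
    using assms(2) by (auto simp: walk_points_def)
  moreover have "(?l ! i, ?l ! Suc i) \<in> E"
    using assms(1) successively_nth i(1) unfolding ipath_def by fast
  moreover have "?l ! i \<in> set ?l" "?l ! Suc i \<in> set ?l" using i(1) by (simp_all only: nth_mem Suc_lessD)
  ultimately show ?thesis using that ipath_no_shortcut[OF assms(1) _ i(1)] by blast
qed

text \<open>The arc of the first edge meets the rest only in \<open>p v\<close>: a common point is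
  an end of both edges concerned, and \<open>u\<close> does not recur in the list.\<close>

lemma path_arc:
  assumes "distinct xs" "successively (\<lambda>u v. (u, v) \<in> E) xs" "length xs \<ge> 2"
  shows "\<exists>g. arc g \<and> pathstart g = p (hd xs) \<and> pathfinish g = p (last xs) \<and>
    path_image g = walk_points A xs"
  using assms
proof (induction xs rule: induct_list012)
  case (3 u v vs)
  have uv: "(u, v) \<in> E" using 3 by simp
  obtain g where g: "arc g" "pathstart g = p u" "pathfinish g = p v" "path_image g = A {u, v}"
    using edge_arc[OF uv] .
  show ?case
  proof (cases "vs = []")
    case True
    then show ?thesis using g by auto
  next
    case False
    then obtain h where h: "arc h" "pathstart h = p v" "pathfinish h = p (last (v # vs))"
      "path_image h = walk_points A (v # vs)"
      using "3.IH"(2) "3.prems" by (cases vs) auto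
    have "A {u, v} \<inter> walk_points A (v # vs) \<subseteq> {p v}"
    proof
      fix z assume z: "z \<in> A {u, v} \<inter> walk_points A (v # vs)"
      have "successively (\<lambda>u v. (u, v) \<in> E) (v # vs)" using "3.prems" by simp
      then obtain x y where i: "(x, y) \<in> E" "z \<in> A {x, y}" "x \<in> set (v # vs)" "y \<in> set (v # vs)"
        using walk_edge z by (metis IntD2)
      have u: "u \<notin> set (v # vs)" using "3.prems" by auto
      then have "{u, v} \<noteq> {x, y}" using i(3,4) by (auto simp: doubleton_eq_iff)
      then obtain w where "w \<in> {u, v}" "w \<in> {x, y}" "z = p w"
        using edges_meet[OF uv i(1)] i(2) z by blast
      then show "z \<in> {p v}" using u i by blast
    qed
    then have "arc (g +++ h)" using g h by (intro arc_join) auto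
    then show ?thesis using g h False
      by (intro exI[of _ "g +++ h"]) (auto simp: path_image_join walk_points_Cons2)
  qed
qed auto

lemma ipath_arc:
  assumes "ipath E a xs b"
  obtains g where "arc g" "pathstart g = p a" "pathfinish g = p b"
    "path_image g = walk_points A (a # xs @ [b])"
  using path_arc[of "a # xs @ [b]"] assms by (auto simp: ipath_def)

lemma ipath_verts:
  assumes "ipath E a xs b"
  shows "set (a # xs @ [b]) \<subseteq> V"
proof
  fix x assume "x \<in> set (a # xs @ [b])"
  then obtain i where i: "i < length (a # xs @ [b])" "x = (a # xs @ [b]) ! i"
    by (metis in_set_conv_nth)
  have s: "successively (\<lambda>u v. (u, v) \<in> E) (a # xs @ [b])" using assms by (simp add: ipath_def)
  show "x \<in> V"
  proof (cases i)
    case 0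
    then show ?thesis using successively_nth[OF s, of 0] i edge_verts by auto
  next
    case (Suc j)
    then show ?thesis using successively_nth[OF s, of j] i edge_verts by auto
  qed
qed

lemma ipath_inner_vertex:
  assumes "ipath E a xs b" "w \<in> set xs"
  shows "p w \<in> walk_points A (a # xs @ [b]) - {p a, p b}"
proof -
  let ?l = "a # xs @ [b]"
  obtain i where i: "i < length xs" "w = xs ! i" using assms by (metis in_set_conv_nth)
  have e: "(?l ! i, ?l ! Suc i) \<in> E" "?l ! Suc i = w"
    using assms i successively_nth[of _ ?l i] by (auto simp: ipath_def nth_append)
  then have "p w \<in> A {?l ! i, ?l ! Suc i}" using edge_vertex edge_verts by blast
  then have "p w \<in> walk_points A ?l" using i unfolding walk_points_def by (intro UN_I[of i]) auto
  moreover have "w \<noteq> a" "w \<noteq> b" using assms by (auto simp: ipath_def)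
  ultimately show ?thesis using inj_p ipath_verts[OF assms(1)] assms(2) by (auto dest: inj_onD)
qed

text \<open>A common point of two different edges is a common end, hence \<open>a\<close> or
  \<open>b\<close>. The paths could share an edge only if it joined \<open>a\<close> to
  \<open>b\<close>, and \<open>ne\<close> prevents both from consisting of that edge.\<close>

lemma ipaths_meet:
  assumes P: "ipath E a xs b" and Q: "ipath E a ys b" and dis: "set xs \<inter> set ys = {}"
    and ne: "xs \<noteq> [] \<or> ys \<noteq> []"
  shows "walk_points A (a # xs @ [b]) \<inter> walk_points A (a # ys @ [b]) = {p a, p b}"
proof
  show "{p a, p b} \<subseteq> walk_points A (a # xs @ [b]) \<inter> walk_points A (a # ys @ [b])"
    using ipath_arc[OF P] ipath_arc[OF Q]
    by (metis Int_iff empty_subsetI insert_subset pathfinish_in_path_image pathstart_in_path_image)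
next
  let ?l = "a # xs @ [b]" let ?m = "a # ys @ [b]"
  have ab: "set ?l \<inter> set ?m = {a, b}" using P Q dis by (auto simp: ipath_def)
  show "walk_points A ?l \<inter> walk_points A ?m \<subseteq> {p a, p b}"
  proof
    fix z assume z: "z \<in> walk_points A ?l \<inter> walk_points A ?m"
    obtain u v where i: "(u, v) \<in> E" "z \<in> A {u, v}" "u \<in> set ?l" "v \<in> set ?l"
      "xs \<noteq> [] \<Longrightarrow> {u, v} \<noteq> {a, b}"
      using ipath_edge[OF P] z by (metis IntD1)
    obtain x y where j: "(x, y) \<in> E" "z \<in> A {x, y}" "x \<in> set ?m" "y \<in> set ?m"
      "ys \<noteq> [] \<Longrightarrow> {x, y} \<noteq> {a, b}"
      using ipath_edge[OF Q] z by (metis IntD2)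
    have "{u, v} \<noteq> {x, y}"
    proof
      assume eq: "{u, v} = {x, y}"
      then have "u \<in> {x, y}" "v \<in> {x, y}" by auto
      then have "u \<in> set ?m" "v \<in> set ?m" using j(3,4) by auto
      then have "u \<in> {a, b}" "v \<in> {a, b}" using i(3,4) ab by (metis IntI)+
      then have "{u, v} = {a, b}" using edge_verts[OF i(1)] by auto
      then show False using ne i(5) j(5) eq by auto
    qed
    then obtain w where w: "w \<in> {u, v}" "w \<in> {x, y}" "z = p w"
      using edges_meet i j by metis
    then have "w \<in> set ?l" "w \<in> set ?m" using i(3,4) j(3,4) by auto
    then have "w \<in> {a, b}" using ab by (metis IntI)
    then show "z \<in> {p a, p b}" using w by auto
  qed
qed

text \<open>The middle path may be a single edge; in this form a chord of a cycle occurs.\<close>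

lemma theta_of_ipaths:
  assumes "ipath E a xs b" "ipath E a ys b" "ipath E a zs b"
    and "set xs \<inter> set ys = {}" "set xs \<inter> set zs = {}" "set ys \<inter> set zs = {}" "xs \<noteq> []" "zs \<noteq> []"
  obtains g1 g2 g3 where "theta_curve g1 g2 g3 (p a) (p b)"
    "path_image g1 = walk_points A (a # xs @ [b])" "path_image g2 = walk_points A (a # ys @ [b])"
    "path_image g3 = walk_points A (a # zs @ [b])"
proof -
  obtain g1 where g1: "arc g1" "pathstart g1 = p a" "pathfinish g1 = p b"
    "path_image g1 = walk_points A (a # xs @ [b])" using ipath_arc[OF assms(1)] .
  obtain g2 where g2: "arc g2" "pathstart g2 = p a" "pathfinish g2 = p b"
    "path_image g2 = walk_points A (a # ys @ [b])" using ipath_arc[OF assms(2)] .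
  obtain g3 where g3: "arc g3" "pathstart g3 = p a" "pathfinish g3 = p b"
    "path_image g3 = walk_points A (a # zs @ [b])" using ipath_arc[OF assms(3)] .
  have "theta_curve g1 g2 g3 (p a) (p b)"
    by unfold_locales (use g1 g2 g3 ipaths_meet assms in simp_all)
  then show ?thesis using that g1 g2 g3 by blast
qed

lemma ipaths_separated:
  assumes paths: "ipath E a xs b" "ipath E a ys b" "ipath E a zs b"
    "set xs \<inter> set ys = {}" "set xs \<inter> set zs = {}" "set ys \<inter> set zs = {}"
    and S: "Topological_Spaces.connected S" "s \<in> S"
      "S \<inter> walk_points A (a # xs @ [b]) = {}" "S \<inter> walk_points A (a # ys @ [b]) = {}"
      "S \<inter> walk_points A (a # zs @ [b]) = {}"
    and x: "x \<in> set xs" "p x \<in> closure S" and z: "z \<in> set zs" "p z \<in> closure S"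
    and y: "y \<in> walk_points A (a # ys @ [b]) - {p a, p b}"
  shows "\<not> connected_component (- (walk_points A (a # xs @ [b]) \<union> walk_points A (a # zs @ [b]))) s y"
proof -
  obtain g1 g2 g3 where g: "theta_curve g1 g2 g3 (p a) (p b)"
    "path_image g1 = walk_points A (a # xs @ [b])" "path_image g2 = walk_points A (a # ys @ [b])"
    "path_image g3 = walk_points A (a # zs @ [b])"
    using theta_of_ipaths[OF paths] x z by (metis empty_iff empty_set)
  show ?thesis
    using theta_curve.arcs_separated[OF g(1) S(1) _ S(2), of "p x" "p z" y]
      ipath_inner_vertex[OF paths(1) x(1)] ipath_inner_vertex[OF paths(3) z(1)] S x z y
    unfolding g by blast
qed

text \<open>Adjoining the accumulation point \<open>p y\<close> keeps \<open>S\<close> connected and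
  off the two outer paths. So \<open>S\<close> would be joined to the middle path, which
  \<open>ipaths_separated\<close> excludes.\<close>

lemma no_three_ipaths:
  assumes paths: "ipath E a xs b" "ipath E a ys b" "ipath E a zs b"
    "set xs \<inter> set ys = {}" "set xs \<inter> set zs = {}" "set ys \<inter> set zs = {}"
    and S: "Topological_Spaces.connected S"
      "S \<inter> walk_points A (a # xs @ [b]) = {}" "S \<inter> walk_points A (a # ys @ [b]) = {}"
      "S \<inter> walk_points A (a # zs @ [b]) = {}"
    and x: "x \<in> set xs" "p x \<in> closure S" and y: "y \<in> set ys" "p y \<in> closure S"
    and z: "z \<in> set zs" "p z \<in> closure S"
  shows False
proof -
  let ?C = "walk_points A (a # xs @ [b]) \<union> walk_points A (a # zs @ [b])"
  obtain s where s: "s \<in> S" using x(2) by (metis closure_empty empty_iff equals0I)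
  have py: "p y \<in> walk_points A (a # ys @ [b]) - {p a, p b}"
    using ipath_inner_vertex[OF paths(2) y(1)] .
  have "Topological_Spaces.connected (insert (p y) S)"
    using S(1) y(2) by (intro connected_intermediate_closure[OF S(1)]) (auto intro: closure_subset[THEN subsetD])
  moreover have "p y \<notin> ?C"
  proof -
    have "xs \<noteq> []" "zs \<noteq> []" using x z by auto
    then show ?thesis
      using ipaths_meet[OF paths(1,2,4)] ipaths_meet[OF paths(2,3,6)] py by blast
  qed
  then have "insert (p y) S \<subseteq> - ?C" using S by blast
  ultimately have "connected_component (- ?C) s (p y)"
    unfolding connected_component_def using s by blast
  then show False
    using ipaths_separated[OF paths S(1) s S(2-4) x z py] by blast
qed

text \<open>Stands in for the contraction of \<open>W\<close> to a single vertex.\<close>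

definition star_nbhd :: "'a set \<Rightarrow> complex set" where
  "star_nbhd W = p ` W \<union> (\<Union>(u, w) \<in> {(u, w) \<in> E. u \<in> W}. A {u, w} - p ` (V - W))"

lemma star_nbhd_edge:
  assumes "W \<subseteq> V" "u \<in> W" "(u, w) \<in> E"
  shows "A {u, w} - {p w} \<subseteq> star_nbhd W"
proof
  fix z assume z: "z \<in> A {u, w} - {p w}"
  have "z \<notin> p ` (V - W)" using z assms edge_vertex[OF assms(3)] by auto
  then show "z \<in> star_nbhd W" using z assms by (auto simp: star_nbhd_def)
qed

text \<open>The arcs of the star that leave \<open>W\<close> have lost their far ends, the only
  points where a walk outside \<open>W\<close> could meet them.\<close>

lemma star_nbhd_walk:
  assumes "W \<subseteq> V" "set xs \<inter> W = {}" "successively (\<lambda>u v. (u, v) \<in> E) xs"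
  shows "star_nbhd W \<inter> walk_points A xs = {}"
proof (rule ccontr)
  assume "\<not> ?thesis"
  then obtain z where z: "z \<in> star_nbhd W" "z \<in> walk_points A xs" by blast
  obtain x y where i: "(x, y) \<in> E" "z \<in> A {x, y}" "x \<in> set xs" "y \<in> set xs"
    using walk_edge[OF assms(3) z(2)] by blast
  from z(1) consider u where "u \<in> W" "z = p u"
    | u w where "(u, w) \<in> E" "u \<in> W" "z \<in> A {u, w}" "z \<notin> p ` (V - W)"
    by (auto simp: star_nbhd_def)
  then show False
  proof cases
    case 1
    then have "u \<in> {x, y}" using edge_vertex[OF i(1)] i(2) assms(1) by blast
    then show False using 1 i assms by blast
  next
    case 2
    then have "u \<notin> set xs" using assms(2) by blast
    then have "{u, w} \<noteq> {x, y}" using i(3,4) by (auto simp: doubleton_eq_iff)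
    then obtain v where v: "v \<in> {u, w}" "v \<in> {x, y}" "z = p v"
      using edges_meet 2 i by metis
    then have "v \<in> set xs" "v \<in> V" using i edge_verts[OF i(1)] by auto
    then have "v \<in> V - W" using assms(2) by blast
    then show False using 2 v by blast
  qed
qed

lemma star_nbhd_closure:
  assumes "W \<subseteq> V" "u \<in> W" "(u, w) \<in> E"
  shows "p w \<in> closure (star_nbhd W)"
proof -
  obtain g where g: "arc g" "pathstart g = p u" "pathfinish g = p w" "path_image g = A {u, w}"
    using edge_arc[OF assms(3)] .
  then have "p w \<in> closure (A {u, w} - {p w})" using arc_end_in_closure by metis
  then show ?thesis using closure_mono[OF star_nbhd_edge[OF assms]] by blast
qed

text \<open>Every point of the star is joined along its arc to an end in \<open>W\<close>, since an
  arc stays connected when its far end is removed. The vertices of \<open>W\<close> are joined along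
  the edges inside \<open>W\<close>.\<close>

lemma connected_star_nbhd:
  assumes "W \<subseteq> V" "connected_in E W"
  shows "Topological_Spaces.connected (star_nbhd W)"
proof -
  let ?cc = "connected_component (star_nbhd W)"
  have p_in: "p w \<in> star_nbhd W" if "w \<in> W" for w using that by (auto simp: star_nbhd_def)
  have edge: "?cc (p u) z" if uw: "u \<in> W" "(u, w) \<in> E" and z: "z \<in> A {u, w} - p ` (V - W)" for u w z
  proof -
    obtain g where g: "arc g" "pathstart g = p u" "pathfinish g = p w" "path_image g = A {u, w}"
      using edge_arc[OF uw(2)] .
    have con: "Topological_Spaces.connected (A {u, w} - {p w})" "Topological_Spaces.connected (A {u, w})"
      using connected_arc_minus_end[OF g(1)] g arc_imp_path connected_path_image by metis+
    show ?thesis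
    proof (cases "w \<in> W")
      case True
      then have "A {u, w} \<subseteq> star_nbhd W"
        using star_nbhd_edge[OF assms(1) uw] p_in by blast
      moreover have "p u \<in> A {u, w}" using edge_vertex edge_verts uw by blast
      ultimately show ?thesis unfolding connected_component_def using con z by blast
    next
      case False
      then have "z \<noteq> p w" using z edge_verts uw by blast
      moreover have "p u \<in> A {u, w} - {p w}"
        using edge_vertex edge_verts[OF uw(2)] inj_p uw(2) by (auto dest: inj_onD)
      ultimately show ?thesis unfolding connected_component_def
        using con star_nbhd_edge[OF assms(1) uw] z by blast
    qed
  qed
  obtain w0 where w0: "w0 \<in> W" using assms by (auto simp: connected_in_def)
  have vert: "?cc (p w0) (p w)" if "w \<in> W" for w
  proof -
    have "(w0, w) \<in> (E \<inter> W \<times> W)\<^sup>*" using assms(2) w0 that by (simp add: connected_in_def)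
    then show ?thesis
    proof (induction rule: rtrancl_induct)
      case base
      then show ?case using p_in w0 by simp
    next
      case (step x y)
      then have "p y \<in> A {x, y} - p ` (V - W)"
        using edge_vertex edge_verts inj_p by (auto dest!: inj_onD)
      then show ?case using edge step connected_component_trans by (metis IntE SigmaD1)
    qed
  qed
  have "?cc (p w0) z" if z: "z \<in> star_nbhd W" for z
  proof -
    from z consider w where "w \<in> W" "z = p w"
      | u w where "(u, w) \<in> E" "u \<in> W" "z \<in> A {u, w} - p ` (V - W)"
      unfolding star_nbhd_def by blast
    then show ?thesis
    proof cases
      case 1
      then show ?thesis using vert by blast
    next
      case 2
      then show ?thesis using connected_component_trans[OF vert edge] by blast
    qed
  qed
  then show ?thesis
    unfolding connected_iff_connected_component by (metis connected_component_sym connected_component_trans)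
qed

text \<open>Contracting \<open>W\<close> leaves a subdivision of \<open>K_{3,3}\<close>: one side
  consists of \<open>a\<close>, \<open>b\<close> and the contracted vertex, the other of
  \<open>x\<close>, \<open>y\<close>, \<open>z\<close>. The star of \<open>W\<close> accumulates at
  an inner vertex of each of the three paths.\<close>

theorem no_K33_subdivision:
  assumes paths: "ipath E a xs b" "ipath E a ys b" "ipath E a zs b"
    "set xs \<inter> set ys = {}" "set xs \<inter> set zs = {}" "set ys \<inter> set zs = {}"
    and W: "W \<subseteq> V" "connected_in E W" "W \<inter> (set xs \<union> set ys \<union> set zs \<union> {a, b}) = {}"
    and x: "u \<in> W" "(u, x) \<in> E" "x \<in> set xs" and y: "v \<in> W" "(v, y) \<in> E" "y \<in> set ys"
    and z: "w \<in> W" "(w, z) \<in> E" "z \<in> set zs"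
  shows False
proof (rule no_three_ipaths[OF paths connected_star_nbhd[OF W(1,2)]])
  show "star_nbhd W \<inter> walk_points A (a # xs @ [b]) = {}" "star_nbhd W \<inter> walk_points A (a # ys @ [b]) = {}"
    "star_nbhd W \<inter> walk_points A (a # zs @ [b]) = {}"
    by (rule star_nbhd_walk[OF W(1)]; use W(3) paths(1-3) in \<open>auto simp: ipath_def\<close>)+
qed (use x y z star_nbhd_closure W in auto)

end

section \<open>Connectivity and isomorphisms\<close>

lemma rtrancl_on_iff: "(a, b) \<in> rtrancl_on F r \<longleftrightarrow> a \<in> F \<and> (a, b) \<in> (r \<inter> F \<times> F)\<^sup>*"
proof
  assume "(a, b) \<in> rtrancl_on F r"
  then have "a \<in> F \<and> b \<in> F \<and> (a, b) \<in> (r \<inter> F \<times> F)\<^sup>*"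
    by induction (auto intro: rtrancl_into_rtrancl converse_rtrancl_into_rtrancl)
  then show "a \<in> F \<and> (a, b) \<in> (r \<inter> F \<times> F)\<^sup>*" by blast
next
  assume *: "a \<in> F \<and> (a, b) \<in> (r \<inter> F \<times> F)\<^sup>*"
  then have "(a, b) \<in> (r \<inter> F \<times> F)\<^sup>*" by blast
  then show "(a, b) \<in> rtrancl_on F r"
    by induction (use * in \<open>auto intro: rtrancl_on_into_rtrancl_on\<close>)
qed

text \<open>\<open>mk_symmetric\<close> adds nothing here, because each edge is already present as
  two opposite arcs.\<close>

lemma connected_induce_subgraph_iff:
  assumes "pair_graph G" "W \<subseteq> pverts G"
  shows "Digraph_Component.connected (with_proj G \<restriction> W) \<longleftrightarrow> connected_in (parcs G) W"
proof -
  let ?M = "mk_symmetric (with_proj G \<restriction> W)"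
  have "(v, u) \<in> parcs G" if "(u, v) \<in> parcs G" for u v
    using pair_graph_edge[OF assms(1) that] by blast
  then have "pverts ?M = W" "parcs ?M = parcs G \<inter> W \<times> W"
    by (force simp: mk_symmetric_def induce_subgraph_def)+
  then have "strongly_connected ?M \<longleftrightarrow> W \<noteq> {} \<and>
      (\<forall>u\<in>W. \<forall>v\<in>W. (u, v) \<in> rtrancl_on W (parcs G \<inter> W \<times> W))"
    by (simp add: strongly_connected_def reachable_def)
  moreover have "parcs G \<inter> W \<times> W \<inter> W \<times> W = parcs G \<inter> W \<times> W" by blast
  ultimately show ?thesis
    by (simp add: Digraph_Component.connected_def connected_in_def rtrancl_on_iff)
qed

lemma k_connected_iff:
  assumes "pair_graph G"
  shows "k_connected k G \<longleftrightarrow> k < card (pverts G) \<and>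
    (\<forall>S \<subseteq> pverts G. card S < k \<longrightarrow> connected_in (parcs G) (pverts G - S))"
  unfolding k_connected_def
  by (auto simp: connected_induce_subgraph_iff[OF assms])

lemma pair_graph_finite: "pair_graph G \<Longrightarrow> finite (pverts G)"
proof -
  assume "pair_graph G"
  then interpret pair_graph G .
  show ?thesis by (rule pair_finite_verts)
qed

lemma connected_inI:
  assumes "r \<in> W" "sym E" "\<And>w. w \<in> W \<Longrightarrow> (r, w) \<in> (E \<inter> W \<times> W)\<^sup>*"
  shows "connected_in E W"
proof -
  have "sym (E \<inter> W \<times> W)" using assms(2) by (auto simp: sym_def)
  then have "sym ((E \<inter> W \<times> W)\<^sup>*)" by (rule sym_rtrancl)
  then show ?thesis
    using assms(1,3) unfolding connected_in_def by (metis empty_iff rtrancl_trans symD)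
qed

lemma pair_graph_sym: "pair_graph G \<Longrightarrow> sym (parcs G)"
  using pair_graph_edge by (metis symI)

lemma connected_in_successively:
  assumes "xs \<noteq> []" "successively (\<lambda>u v. (u, v) \<in> E) xs" "sym E"
  shows "connected_in E (set xs)"
proof (rule connected_inI[of "hd xs"])
  fix w assume "w \<in> set xs"
  then obtain i where i: "i < length xs" "w = xs ! i" by (metis in_set_conv_nth)
  then have "(hd xs, xs ! i) \<in> (E \<inter> set xs \<times> set xs)\<^sup>*"
  proof (induction i arbitrary: w)
    case 0
    then show ?case by (simp add: hd_conv_nth)
  next
    case (Suc i)
    then have "(xs ! i, xs ! Suc i) \<in> E \<inter> set xs \<times> set xs"
      using successively_nth[OF assms(2)] by simp
    then show ?case using Suc by (meson Suc_lessD rtrancl.rtrancl_into_rtrancl)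
  qed
  then show "(hd xs, w) \<in> (E \<inter> set xs \<times> set xs)\<^sup>*" using i by simp
qed (use assms in auto)

text \<open>Edges may collapse to a vertex, so that the projections of a product are covered along
  with isomorphisms and embeddings of a factor.\<close>

lemma connected_in_image:
  assumes "connected_in E W" "\<And>u v. (u, v) \<in> E \<Longrightarrow> u \<in> W \<Longrightarrow> v \<in> W \<Longrightarrow> f u = f v \<or> (f u, f v) \<in> E'"
  shows "connected_in E' (f ` W)"
proof -
  have "(f u, f v) \<in> (E' \<inter> f ` W \<times> f ` W)\<^sup>*" if "(u, v) \<in> (E \<inter> W \<times> W)\<^sup>*" for u v
    using that
  proof induction
    case (step y z)
    then have "f y = f z \<or> (f y, f z) \<in> E' \<inter> f ` W \<times> f ` W" using assms(2) by blast
    then show ?case using step.IH by (metis rtrancl.rtrancl_into_rtrancl)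
  qed simp
  then show ?thesis using assms(1) by (auto simp: connected_in_def)
qed

text \<open>Often used in the contrapositive, to find an edge that leaves a proper nonempty
  subset.\<close>

lemma connected_in_closed:
  assumes "connected_in E W" "X \<subseteq> W" "X \<noteq> {}" "\<And>u v. u \<in> X \<Longrightarrow> (u, v) \<in> E \<Longrightarrow> v \<in> W \<Longrightarrow> v \<in> X"
  shows "X = W"
proof -
  obtain x where x: "x \<in> X" using assms(3) by blast
  have "w \<in> X" if "w \<in> W" for w
  proof -
    have "(x, w) \<in> (E \<inter> W \<times> W)\<^sup>*" using assms(1,2) x that by (auto simp: connected_in_def)
    then show ?thesis by induction (use x assms(4) in auto)
  qed
  then show ?thesis using assms(2) by blast
qed

lemma graph_isoI:
  assumes "pair_graph G" "pair_graph H" "bij_betw f (pverts G) (pverts H)"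
    "\<And>u v. u \<in> pverts G \<Longrightarrow> v \<in> pverts G \<Longrightarrow> (u, v) \<in> parcs G \<longleftrightarrow> (f u, f v) \<in> parcs H"
  shows "G \<simeq>\<^sub>G H"
  using assms graph_iso_iff by blast

lemma graph_isoE:
  assumes "G \<simeq>\<^sub>G H" "pair_graph G" "pair_graph H"
  obtains f where "bij_betw f (pverts G) (pverts H)"
    "\<And>u v. u \<in> pverts G \<Longrightarrow> v \<in> pverts G \<Longrightarrow> (u, v) \<in> parcs G \<longleftrightarrow> (f u, f v) \<in> parcs H"
  using assms graph_iso_iff by blast

lemma graph_iso_sym:
  assumes "G \<simeq>\<^sub>G H" "pair_graph G" "pair_graph H"
  shows "H \<simeq>\<^sub>G G"
proof -
  obtain f where f: "bij_betw f (pverts G) (pverts H)"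
    "\<And>u v. u \<in> pverts G \<Longrightarrow> v \<in> pverts G \<Longrightarrow> (u, v) \<in> parcs G \<longleftrightarrow> (f u, f v) \<in> parcs H"
    using graph_isoE[OF assms] by blast
  let ?g = "inv_into (pverts G) f"
  have "bij_betw ?g (pverts H) (pverts G)" by (rule bij_betw_inv_into[OF f(1)])
  moreover have "(u, v) \<in> parcs H \<longleftrightarrow> (?g u, ?g v) \<in> parcs G"
    if "u \<in> pverts H" "v \<in> pverts H" for u v
  proof -
    have "?g u \<in> pverts G" "?g v \<in> pverts G" "f (?g u) = u" "f (?g v) = v"
      using that f(1) by (auto simp: bij_betw_def inv_into_into f_inv_into_f)
    then show ?thesis using f(2) by metis
  qed
  ultimately show ?thesis using assms graph_isoI by blast
qed

lemma graph_iso_trans: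
  assumes "F \<simeq>\<^sub>G G" "G \<simeq>\<^sub>G H" "pair_graph F" "pair_graph G" "pair_graph H"
  shows "F \<simeq>\<^sub>G H"
proof -
  obtain f where f: "bij_betw f (pverts F) (pverts G)"
    "\<And>u v. u \<in> pverts F \<Longrightarrow> v \<in> pverts F \<Longrightarrow> (u, v) \<in> parcs F \<longleftrightarrow> (f u, f v) \<in> parcs G"
    using graph_isoE assms by blast
  obtain g where g: "bij_betw g (pverts G) (pverts H)"
    "\<And>u v. u \<in> pverts G \<Longrightarrow> v \<in> pverts G \<Longrightarrow> (u, v) \<in> parcs G \<longleftrightarrow> (g u, g v) \<in> parcs H"
    using graph_isoE assms by blast
  have "f u \<in> pverts G" if "u \<in> pverts F" for u using f(1) that by (auto simp: bij_betw_def)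
  then show ?thesis
    using assms f g by (intro graph_isoI[of F H "g \<circ> f"]) (auto intro: bij_betw_trans)
qed

lemma verts_cart_prod [simp]: "pverts (H \<box> J) = pverts H \<times> pverts J"
  by (simp add: cart_prod_def)

lemma arcs_cart_prod [simp]: "((a, x), (b, y)) \<in> parcs (H \<box> J) \<longleftrightarrow>
    (a = b \<and> a \<in> pverts H \<and> (x, y) \<in> parcs J) \<or> ((a, b) \<in> parcs H \<and> x = y \<and> x \<in> pverts J)"
  by (simp add: cart_prod_def)

lemma graph_iso_cart_prod:
  assumes "H \<simeq>\<^sub>G H'" "J \<simeq>\<^sub>G J'" "pair_graph H" "pair_graph H'" "pair_graph J" "pair_graph J'"
  shows "H \<box> J \<simeq>\<^sub>G H' \<box> J'"
proof -
  obtain f where f: "bij_betw f (pverts H) (pverts H')"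
    "\<And>u v. u \<in> pverts H \<Longrightarrow> v \<in> pverts H \<Longrightarrow> (u, v) \<in> parcs H \<longleftrightarrow> (f u, f v) \<in> parcs H'"
    using graph_isoE assms by blast
  obtain g where g: "bij_betw g (pverts J) (pverts J')"
    "\<And>u v. u \<in> pverts J \<Longrightarrow> v \<in> pverts J \<Longrightarrow> (u, v) \<in> parcs J \<longleftrightarrow> (g u, g v) \<in> parcs J'"
    using graph_isoE assms by blast
  have in_img: "f u \<in> pverts H'" if "u \<in> pverts H" for u using f(1) that by (auto simp: bij_betw_def)
  have in_img': "g u \<in> pverts J'" if "u \<in> pverts J" for u using g(1) that by (auto simp: bij_betw_def)
  have eq: "f u = f v \<longleftrightarrow> u = v" if "u \<in> pverts H" "v \<in> pverts H" for u v
    using f(1) that by (auto simp: bij_betw_def inj_on_def)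
  have eq': "g u = g v \<longleftrightarrow> u = v" if "u \<in> pverts J" "v \<in> pverts J" for u v
    using g(1) that by (auto simp: bij_betw_def inj_on_def)
  show ?thesis
    using assms
    by (intro graph_isoI[of _ _ "map_prod f g"])
      (auto simp: pair_graph_cart_prod f(2) g(2) eq eq' in_img in_img' intro: bij_betw_map_prod f(1) g(1))
qed

lemma graph_iso_cart_prod_commute:
  assumes "pair_graph H" "pair_graph J"
  shows "H \<box> J \<simeq>\<^sub>G J \<box> H"
proof (rule graph_isoI[of _ _ prod.swap])
  show "bij_betw prod.swap (pverts (H \<box> J)) (pverts (J \<box> H))"
    by (auto simp: bij_betw_def inj_on_def)
qed (use assms pair_graph_cart_prod in auto)

lemma k_connected_iso:
  assumes "G \<simeq>\<^sub>G H" "pair_graph G" "pair_graph H" "k_connected k G"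
  shows "k_connected k H"
proof -
  obtain f where f: "bij_betw f (pverts G) (pverts H)"
    "\<And>u v. u \<in> pverts G \<Longrightarrow> v \<in> pverts G \<Longrightarrow> (u, v) \<in> parcs G \<longleftrightarrow> (f u, f v) \<in> parcs H"
    using graph_isoE[OF assms(1-3)] by blast
  have inj: "inj_on f (pverts G)" and im: "f ` pverts G = pverts H" using f(1) by (auto simp: bij_betw_def)
  have "connected_in (parcs H) (pverts H - S)" if S: "S \<subseteq> pverts H" "card S < k" for S
  proof -
    obtain S' where S': "S' \<subseteq> pverts G" "S = f ` S'" using S im by (metis subset_image_iff)
    have "card S' = card S" using S' inj by (metis card_image inj_on_subset)
    then have "connected_in (parcs G) (pverts G - S')"
      using assms(4) S S' k_connected_iff[OF assms(2)] by simp
    then have "connected_in (parcs H) (f ` (pverts G - S'))"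
      by (rule connected_in_image) (use f(2) in auto)
    moreover have "f ` (pverts G - S') = pverts H - S"
      using S' inj im by (metis Diff_subset inj_on_image_set_diff)
    ultimately show ?thesis by simp
  qed
  moreover have "card (pverts H) = card (pverts G)" using f(1) by (simp add: bij_betw_same_card)
  ultimately show ?thesis
    using assms(4) k_connected_iff[OF assms(2)] k_connected_iff[OF assms(3)] by simp
qed

lemma plane_drawingI:
  assumes "inj_on p (pverts G)"
    and "\<And>u v. (u, v) \<in> parcs G \<Longrightarrow>
      \<exists>g. arc g \<and> pathstart g = p u \<and> pathfinish g = p v \<and> path_image g = A {u, v}"
    and "\<And>u v. (u, v) \<in> parcs G \<Longrightarrow> A {u, v} \<inter> p ` pverts G \<subseteq> {p u, p v}"
    and "\<And>u v x y. (u, v) \<in> parcs G \<Longrightarrow> (x, y) \<in> parcs G \<Longrightarrow> {u, v} \<noteq> {x, y} \<Longrightarrow>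
      A {u, v} \<inter> A {x, y} \<subseteq> p ` pverts G"
    and "pair_graph G"
  shows "plane_drawing G p A"
proof -
  have "A {u, v} \<inter> p ` pverts G = {p u, p v}" if uv: "(u, v) \<in> parcs G" for u v
  proof -
    obtain g where g: "pathstart g = p u" "pathfinish g = p v" "path_image g = A {u, v}"
      using assms(2)[OF uv] by blast
    then have "p u \<in> A {u, v}" "p v \<in> A {u, v}"
      using pathstart_in_path_image[of g] pathfinish_in_path_image[of g] by simp_all
    then show ?thesis
      using assms(3)[OF uv] pair_graph_edge[OF assms(5) uv] by blast
  qed
  then show ?thesis
    unfolding plane_drawing_def Ball_def split_paired_All prod.case
    by (intro conjI allI impI assms(1,2,4))
qed

lemma drawing_meet:
  assumes "plane_drawing G p A" "(u, v) \<in> parcs G" "(x, y) \<in> parcs G" "{u, v} \<noteq> {x, y}"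
  shows "A {u, v} \<inter> A {x, y} \<subseteq> p ` pverts G"
  using assms unfolding plane_drawing_def by blast

lemma planar_iso:
  assumes "G \<simeq>\<^sub>G H" "pair_graph G" "pair_graph H" "planar H"
  shows "planar G"
proof -
  obtain f where f: "bij_betw f (pverts G) (pverts H)"
    "\<And>u v. u \<in> pverts G \<Longrightarrow> v \<in> pverts G \<Longrightarrow> (u, v) \<in> parcs G \<longleftrightarrow> (f u, f v) \<in> parcs H"
    using graph_isoE[OF assms(1-3)] by blast
  have inj: "inj_on f (pverts G)" and im: "f ` pverts G = pverts H" using f(1) by (auto simp: bij_betw_def)
  obtain p A where d: "plane_drawing H p A" using assms(4) by (auto simp: planar_def)
  interpret H: drawn_graph H p A using assms(3) d by (rule drawn_graph.intro)
  have e: "(f u, f v) \<in> parcs H" "u \<in> pverts G" "v \<in> pverts G" if "(u, v) \<in> parcs G" for u v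
    using that pair_graph_edge[OF assms(2) that] f(2) by auto
  have pf: "(p \<circ> f) ` pverts G = p ` pverts H" using im by (metis image_comp)
  have "plane_drawing G (p \<circ> f) (\<lambda>e. A (f ` e))"
  proof (rule plane_drawingI)
    show "inj_on (p \<circ> f) (pverts G)" using comp_inj_on[OF inj] H.inj_p im by simp
  next
    fix u v assume uv: "(u, v) \<in> parcs G"
    obtain g where "arc g" "pathstart g = p (f u)" "pathfinish g = p (f v)" "path_image g = A {f u, f v}"
      using H.edge_arc[OF e(1)[OF uv]] .
    then show "\<exists>g. arc g \<and> pathstart g = (p \<circ> f) u \<and> pathfinish g = (p \<circ> f) v \<and> path_image g = A (f ` {u, v})"
      by auto
    show "A (f ` {u, v}) \<inter> (p \<circ> f) ` pverts G \<subseteq> {(p \<circ> f) u, (p \<circ> f) v}"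
      using H.edge_vertex[OF e(1)[OF uv]] unfolding pf by auto
  next
    fix u v x y assume uv: "(u, v) \<in> parcs G" and xy: "(x, y) \<in> parcs G" and ne: "{u, v} \<noteq> {x, y}"
    have "f ` {u, v} \<noteq> f ` {x, y}"
      using inj_on_image_eq_iff[OF inj] e(2,3)[OF uv] e(2,3)[OF xy] ne
      by (metis empty_subsetI insert_subset)
    then have "{f u, f v} \<noteq> {f x, f y}" by simp
    then show "A (f ` {u, v}) \<inter> A (f ` {x, y}) \<subseteq> (p \<circ> f) ` pverts G"
      using drawing_meet[OF d e(1)[OF uv] e(1)[OF xy]] unfolding pf by simp
  qed (rule assms(2))
  then show ?thesis by (auto simp: planar_def)
qed

lemma three_polytope_iso:
  assumes "G \<simeq>\<^sub>G H" "pair_graph G" "pair_graph H"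
  shows "three_polytope G \<longleftrightarrow> three_polytope H"
  using assms k_connected_iso[OF assms] k_connected_iso[OF graph_iso_sym[OF assms]]
    planar_iso[OF assms] planar_iso[OF graph_iso_sym[OF assms]]
  by (auto simp: three_polytope_def)

section \<open>Products of claws, paths and cycles\<close>

text \<open>One side of the \<open>K_{3,3}\<close> is \<open>(o', x)\<close>, \<open>(o', z)\<close>
  and \<open>(o', y)\<close>, the other consists of the three leaves paired with \<open>y\<close>.
  Each leaf supplies a detour from \<open>(o', x)\<close> to \<open>(o', z)\<close> through its own
  copy of the path.\<close>

lemma claw_times_path_not_planar:
  assumes "pair_graph H" "pair_graph J"
    and claw: "(o', l1) \<in> parcs H" "(o', l2) \<in> parcs H" "(o', l3) \<in> parcs H" "distinct [l1, l2, l3]"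
    and path: "(x, y) \<in> parcs J" "(y, z) \<in> parcs J" "x \<noteq> z"
  shows "\<not> planar (H \<box> J)"
proof
  assume "planar (H \<box> J)"
  then obtain p A where d: "plane_drawing (H \<box> J) p A" by (auto simp: planar_def)
  interpret D: drawn_graph "H \<box> J" p A
    using pair_graph_cart_prod[OF assms(1,2)] d by (rule drawn_graph.intro)
  have ip: "ipath D.E (o', x) [(l, x), (l, y), (l, z)] (o', z)" if "(o', l) \<in> parcs H" for l
    using pair_graph_edge[OF assms(1) that] pair_graph_edge[OF assms(2) path(1)]
      pair_graph_edge[OF assms(2) path(2)] path that by (auto simp: ipath_def)
  have v: "o' \<in> pverts H" "y \<in> pverts J" "y \<noteq> x" "y \<noteq> z"
    using pair_graph_edge assms(1,2) claw(1) path by metis+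
  have ne: "l \<noteq> o'" if "(o', l) \<in> parcs H" for l using pair_graph_edge[OF assms(1) that] by simp
  show False
    by (rule D.no_K33_subdivision[OF ip[OF claw(1)] ip[OF claw(2)] ip[OF claw(3)], of "{(o', y)}"
          "(o', y)" "(l1, y)" "(o', y)" "(l2, y)" "(o', y)" "(l3, y)"])
      (use claw v ne in \<open>auto simp: connected_in_def\<close>)
qed

text \<open>A list of length two counts as a cycle that runs back and forth along one edge.\<close>

definition is_cycle :: "('a \<times> 'a) set \<Rightarrow> 'a list \<Rightarrow> bool" where
  "is_cycle E c \<longleftrightarrow> distinct c \<and> 2 \<le> length c \<and> successively (\<lambda>u v. (u, v) \<in> E) c \<and>
     (last c, hd c) \<in> E"

text \<open>Three paths join \<open>(h, x)\<close> to \<open>(h, y)\<close>: one along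
  \<open>js\<close> in the row of \<open>h\<close>, and two through the rows of \<open>hd hs\<close>
  and \<open>last hs\<close>, using the edge between \<open>x\<close> and \<open>y\<close>. The
  third branch set is the copy of \<open>hs\<close> in the column of \<open>last js\<close>, a
  vertex adjacent to \<open>y\<close>. Having three vertices in each cycle makes
  \<open>hd hs\<close> and \<open>last hs\<close> different and keeps \<open>last js\<close> apart
  from \<open>x\<close> and \<open>y\<close>.\<close>

lemma cycle_times_cycle_not_planar:
  assumes gr: "pair_graph H" "pair_graph J"
    and H: "is_cycle (parcs H) (h # hs)" "length hs \<ge> 2"
    and J: "is_cycle (parcs J) (x # js @ [y])" "js \<noteq> []"
  shows "\<not> planar (H \<box> J)"
proof
  assume "planar (H \<box> J)"
  then obtain p A where d: "plane_drawing (H \<box> J) p A" by (auto simp: planar_def)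
  interpret D: drawn_graph "H \<box> J" p A
    using pair_graph_cart_prod[OF gr] d by (rule drawn_graph.intro)
  have "hs \<noteq> []" using H by auto
  then have hs: "hs \<noteq> []" "hd hs \<in> set hs" "last hs \<in> set hs" "h \<notin> set hs"
    using H by (auto simp: is_cycle_def)
  have "hd hs \<noteq> last hs"
    using H by (cases hs) (auto simp: is_cycle_def last_conv_nth Suc_le_eq)
  note hs = hs this
  have eH: "(h, hd hs) \<in> parcs H" "(last hs, h) \<in> parcs H" "successively (\<lambda>u v. (u, v) \<in> parcs H) hs"
    using H hs(1) by (auto simp: is_cycle_def successively_Cons)
  have eH': "(hd hs, h) \<in> parcs H" "(h, last hs) \<in> parcs H"
    using pair_graph_edge[OF gr(1)] eH by blast+
  have sJ: "successively (\<lambda>u v. (u, v) \<in> parcs J) (x # js @ [y])" and xy: "(y, x) \<in> parcs J"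
    using J by (auto simp: is_cycle_def)
  have xy': "(x, y) \<in> parcs J" using pair_graph_edge[OF gr(2) xy] by simp
  have jy: "(last js, y) \<in> parcs J" "js \<noteq> []" "last js \<in> set js" "x \<notin> set js" "y \<notin> set js" "x \<noteq> y"
    using sJ J by (auto simp: successively_append_iff successively_Cons is_cycle_def)
  have vH: "h \<in> pverts H" "hd hs \<in> pverts H" "last hs \<in> pverts H"
    using pair_graph_edge[OF gr(1)] eH by blast+
  have vJ: "x \<in> pverts J" "y \<in> pverts J" "last js \<in> pverts J"
    using pair_graph_edge[OF gr(2)] xy jy by blast+
  have hsV: "set hs \<subseteq> pverts H"
  proof
    fix u assume "u \<in> set hs"
    then obtain i where "i < length hs" "u = (h # hs) ! Suc i" by (auto simp: in_set_conv_nth)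
    then show "u \<in> pverts H"
      using successively_nth[of "\<lambda>u v. (u, v) \<in> parcs H" "h # hs" i] H pair_graph_edge(2)[OF gr(1)]
      by (auto simp: is_cycle_def)
  qed
  let ?W = "(\<lambda>u. (u, last js)) ` set hs"
  have "connected_in (parcs H) (set hs)"
    using connected_in_successively[OF hs(1) eH(3)] pair_graph_sym gr(1) by blast
  then have W: "connected_in D.E ?W" by (rule connected_in_image) (use vJ in auto)
  have P1: "ipath D.E (h, x) (map (Pair h) js) (h, y)"
  proof -
    have *: "(h, x) # map (Pair h) js @ [(h, y)] = map (Pair h) (x # js @ [y])" by simp
    have "successively (\<lambda>u v. (u, v) \<in> D.E) (map (Pair h) (x # js @ [y]))"
      unfolding successively_map by (rule successively_mono[OF sJ]) (use vH in auto)
    moreover have "distinct (map (Pair h) (x # js @ [y]))"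
      using J by (subst distinct_map) (auto simp: is_cycle_def inj_on_def)
    ultimately show ?thesis unfolding ipath_def * by blast
  qed
  have P23: "ipath D.E (h, x) [(u, x), (u, y)] (h, y)" if "(h, u) \<in> parcs H" for u
    using pair_graph_edge[OF gr(1) that] that vJ xy' jy by (auto simp: ipath_def)
  show False
    by (rule D.no_K33_subdivision[OF P1 P23[OF eH(1)] P23[OF eH'(2)], of ?W
          "(hd hs, last js)" "(h, last js)" "(hd hs, last js)" "(hd hs, y)" "(last hs, last js)" "(last hs, y)"])
      (use hs jy vH vJ hsV eH eH' W in auto)
qed

lemma is_cycle_upt:
  assumes "n \<ge> 3"
  shows "is_cycle (parcs (cycle_graph n)) [0..<n]"
  using assms by (auto simp: is_cycle_def cycle_graph_def successively_conv_nth last_upt)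

lemma cycle_graph_product_not_planar:
  assumes "n \<ge> 3" "m \<ge> 3"
  shows "\<not> planar (cycle_graph n \<box> cycle_graph m)"
proof -
  have "[0..<n] = 0 # [1..<n]" using assms by (simp add: upt_conv_Cons)
  moreover have "[0..<m] = 0 # [1..<m - 1] @ [m - 1]"
    using assms upt_Suc_append[of 1 "m - 1"] by (simp add: upt_conv_Cons)
  ultimately show ?thesis
    using assms is_cycle_upt[OF assms(1)] is_cycle_upt[OF assms(2)] pair_graph_cycle_graph
    by (intro cycle_times_cycle_not_planar[where h = 0 and hs = "[1..<n]" and x = 0 and js = "[1..<m - 1]" and y = "m - 1"])
      (auto simp flip: One_nat_def)
qed

section \<open>Connectivity of products and of their factors\<close>

lemma k_connected_min_degree:
  assumes "pair_graph G" "k_connected k G" "v \<in> pverts G" "S \<subseteq> pverts G - {v}" "card S < k"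
  obtains w where "(v, w) \<in> parcs G" "w \<notin> S"
proof (rule ccontr)
  assume no: "\<not> thesis"
  have fin: "finite S" using assms pair_graph_finite by (meson finite_Diff finite_subset)
  have "connected_in (parcs G) (pverts G - S)"
    using assms k_connected_iff[OF assms(1)] by blast
  \<comment> \<open>With all neighbours of \<open>v\<close> in \<open>S\<close>, deleting
    \<open>S\<close> isolates \<open>v\<close>. Connectivity then leaves at most \<open>k\<close>
    vertices in the whole graph.\<close>
  then have "{v} = pverts G - S"
    by (rule connected_in_closed) (use assms no that in blast)+
  then have "pverts G \<subseteq> insert v S" by blast
  then have "card (pverts G) \<le> card (insert v S)" using fin by (intro card_mono) auto
  also have "\<dots> \<le> Suc (card S)" using fin by (simp add: card_insert_if)
  finally have "card (pverts G) \<le> Suc (card S)" .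
  then show False using assms k_connected_iff[OF assms(1)] by auto
qed

lemma connected_in_mono_rtrancl:
  assumes "connected_in E W" "u \<in> W" "v \<in> W" "W \<subseteq> P"
  shows "(u, v) \<in> (E \<inter> P \<times> P)\<^sup>*"
proof -
  have "(u, v) \<in> (E \<inter> W \<times> W)\<^sup>*" using assms by (simp add: connected_in_def)
  then show ?thesis by (rule rtrancl_mono[THEN subsetD, rotated]) (use assms(4) in auto)
qed

lemma connected_in_has_neighbor:
  assumes "connected_in E W" "a \<in> W" "W \<noteq> {a}"
  obtains b where "(a, b) \<in> E" "b \<in> W" "b \<noteq> a"
  using connected_in_closed[OF assms(1), of "{a}"] assms by blast

text \<open>At most two rows and columns are hit by \<open>S\<close>, so some column \<open>w\<close> survives entirely; every
  row is attached to it, directly or through a neighbouring row.\<close>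

lemma k_connected_3_cart_prod:
  assumes gr: "pair_graph H" "pair_graph J"
    and H: "connected_in (parcs H) (pverts H)" "card (pverts H) \<ge> 2" and J: "k_connected 2 J"
  shows "k_connected 3 (H \<box> J)"
proof -
  have P: "pair_graph (H \<box> J)" using gr by (rule pair_graph_cart_prod)
  have fin: "finite (pverts H)" "finite (pverts J)" using gr pair_graph_finite by auto
  have J3: "card (pverts J) \<ge> 3" using J k_connected_iff[OF gr(2)] by simp
  have "2 * 3 \<le> card (pverts H) * card (pverts J)" using H(2) J3 by (rule mult_le_mono)
  then have "3 < card (pverts (H \<box> J))" by (simp add: card_cartesian_product)
  moreover have "connected_in (parcs (H \<box> J)) (pverts (H \<box> J) - S)"
    if S: "S \<subseteq> pverts (H \<box> J)" "card S < 3" for S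
  proof -
    let ?E = "parcs (H \<box> J)" let ?P = "pverts (H \<box> J) - S"
    let ?S = "\<lambda>a. {x. (a, x) \<in> S}"
    have finS: "finite S" using S fin finite_subset by fastforce
    have finSa: "finite (?S a)" for a
      by (rule finite_subset[OF _ finite_imageI[OF finS, of snd]]) force
    have "card (snd ` S) < card (pverts J)" using card_image_le[OF finS, of snd] S J3 by simp
    then have "\<not> pverts J \<subseteq> snd ` S" using finS card_mono by (metis finite_imageI not_less)
    then obtain w where w: "w \<in> pverts J" "\<And>a. (a, w) \<notin> S" by force
    have col: "connected_in ?E ((\<lambda>a. (a, w)) ` pverts H)"
      by (rule connected_in_image[OF H(1)]) (use w in auto)
    have row: "((a, x), (a, y)) \<in> (?E \<inter> ?P \<times> ?P)\<^sup>*"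
      if "card (?S a) < 2" "a \<in> pverts H" "(a, x) \<in> ?P" "(a, y) \<in> ?P" for a x y
    proof -
      have "?S a \<subseteq> pverts J" using S by auto
      then have "connected_in (parcs J) (pverts J - ?S a)"
        using that J k_connected_iff[OF gr(2)] by blast
      then have "connected_in ?E (Pair a ` (pverts J - ?S a))"
        by (rule connected_in_image) (use that in auto)
      then show ?thesis by (rule connected_in_mono_rtrancl) (use that in auto)
    qed
    obtain a0 where a0: "a0 \<in> pverts H" using H(1) by (auto simp: connected_in_def)
    show ?thesis
    proof (rule connected_inI[of "(a0, w)"])
      show "(a0, w) \<in> ?P" using a0 w by auto
      show "sym ?E" using P by (rule pair_graph_sym)
      fix v assume v: "v \<in> ?P"
      obtain a x where ax: "v = (a, x)" by (cases v)
      then have in_V: "a \<in> pverts H" "x \<in> pverts J" "(a, x) \<notin> S" using v by auto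
      have to_col: "((a0, w), (b, w)) \<in> (?E \<inter> ?P \<times> ?P)\<^sup>*" if "b \<in> pverts H" for b
        by (rule connected_in_mono_rtrancl[OF col]) (use a0 w that in auto)
      show "((a0, w), v) \<in> (?E \<inter> ?P \<times> ?P)\<^sup>*"
      proof (cases "card (?S a) < 2")
        case True
        then have "((a, w), (a, x)) \<in> (?E \<inter> ?P \<times> ?P)\<^sup>*"
          by (intro row) (use True in_V w in auto)
        then show ?thesis unfolding ax by (rule rtrancl_trans[OF to_col[OF in_V(1)]])
      next
        case False
        \<comment> \<open>\<open>S\<close> has at most two elements and row \<open>a\<close> already
          contains two, so every other row is intact. Hence \<open>(b, x)\<close> is available for
          the crossing from row \<open>b\<close> to row \<open>a\<close>.\<close>
        have sub: "Pair a ` ?S a \<subseteq> S" by auto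
        have "card (Pair a ` ?S a) = card (?S a)" by (intro card_image) (auto simp: inj_on_def)
        then have "Pair a ` ?S a = S"
          using False S(2) by (intro card_subset_eq[OF finS sub]) (use card_mono[OF finS sub] in linarith)
        then have S_row: "b = a" if "(b, y) \<in> S" for b y using that by auto
        have "pverts H \<noteq> {a}" using H(2) by auto
        then obtain b where b: "(a, b) \<in> parcs H" "b \<in> pverts H" "b \<noteq> a"
          using connected_in_has_neighbor[OF H(1) in_V(1)] by blast
        then have "?S b = {}" using S_row by auto
        then have "card (?S b) < 2" by (simp only: card.empty)
        then have to_bx: "((b, w), (b, x)) \<in> (?E \<inter> ?P \<times> ?P)\<^sup>*"
          by (intro row) (use b in_V w S_row in auto)
        have "((b, x), (a, x)) \<in> ?E \<inter> ?P \<times> ?P"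
          using pair_graph_edge[OF gr(1) b(1)] in_V b S_row by auto
        then show ?thesis
          unfolding ax
          by (intro rtrancl_trans[OF to_col[OF b(2)]] rtrancl.rtrancl_into_rtrancl[OF to_bx])
      qed
    qed
  qed
  ultimately show ?thesis using k_connected_iff[OF P] by blast
qed

text \<open>A projection sends every edge of the product to an edge or to a single vertex.\<close>

lemma k_connected_cart_prod_factors:
  assumes gr: "pair_graph H" "pair_graph J" and k: "k_connected k (H \<box> J)" "0 < k"
  shows "connected_in (parcs H) (pverts H)" "connected_in (parcs J) (pverts J)"
proof -
  have c: "connected_in (parcs (H \<box> J)) (pverts H \<times> pverts J)"
    using k k_connected_iff[OF pair_graph_cart_prod[OF gr]] by (metis Diff_empty card.empty empty_subsetI verts_cart_prod)
  then have ne: "pverts H \<times> pverts J \<noteq> {}" by (simp add: connected_in_def)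
  have "connected_in (parcs H) (fst ` (pverts H \<times> pverts J))"
    by (rule connected_in_image[OF c]) auto
  then show "connected_in (parcs H) (pverts H)" using ne by (simp add: fst_image_times split: if_splits)
  have "connected_in (parcs J) (snd ` (pverts H \<times> pverts J))"
    by (rule connected_in_image[OF c]) auto
  then show "connected_in (parcs J) (pverts J)" using ne by (simp add: snd_image_times split: if_splits)
qed

text \<open>Deleting a vertex of \<open>J\<close> corresponds to deleting its two copies; the
  product stays connected, and so does its projection. If \<open>J\<close> had only two vertices, a
  vertex of the product would have at most two neighbours.\<close>

lemma k_connected_2_of_prism:
  assumes gr: "pair_graph K" "pair_graph J" and K: "card (pverts K) = 2"
    and J: "card (pverts J) \<ge> 2" and k: "k_connected 3 (K \<box> J)"
  shows "k_connected 2 J"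
proof -
  note P = pair_graph_cart_prod[OF gr]
  obtain k0 k1 where K01: "pverts K = {k0, k1}" "k0 \<noteq> k1" using K by (meson card_2_iff)
  have "card (pverts J) \<noteq> 2"
  proof
    assume "card (pverts J) = 2"
    then obtain x y where xy: "pverts J = {x, y}" "x \<noteq> y" by (meson card_2_iff)
    have "card {(k1, x), (k0, y)} < 3" by (simp add: card_insert_if)
    then obtain w where "((k0, x), w) \<in> parcs (K \<box> J)" "w \<notin> {(k1, x), (k0, y)}"
      using k_connected_min_degree[OF P k, of "(k0, x)" "{(k1, x), (k0, y)}"] K01 xy by auto
    moreover obtain a z where "w = (a, z)" by (cases w)
    ultimately have "(x, z) \<in> parcs J \<and> z \<noteq> y \<or> (k0, a) \<in> parcs K \<and> a \<noteq> k1" by auto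
    then show False
      using pair_graph_edge(2,3)[OF gr(1), of k0 a] pair_graph_edge(2,3)[OF gr(2), of x z] K01 xy by auto
  qed
  moreover have "connected_in (parcs J) (pverts J - S)" if S: "S \<subseteq> pverts J" "card S < 2" for S
  proof -
    have "card (pverts K \<times> S) < 3" using S K by (simp add: card_cartesian_product)
    then have "connected_in (parcs (K \<box> J)) (pverts (K \<box> J) - pverts K \<times> S)"
      using S k k_connected_iff[OF P] by (metis Sigma_mono subset_refl verts_cart_prod)
    then have "connected_in (parcs J) (snd ` (pverts (K \<box> J) - pverts K \<times> S))"
      by (rule connected_in_image) auto
    moreover have "snd ` (pverts (K \<box> J) - pverts K \<times> S) = pverts J - S"
      using K01 by force
    ultimately show ?thesis by simp
  qed
  ultimately show ?thesis using J k_connected_iff[OF gr(2)] by auto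
qed

text \<open>The corner \<open>(0, 0)\<close> has only two neighbours.\<close>

lemma path_graph_product_not_3_connected:
  assumes "n \<ge> 2" "m \<ge> 2"
  shows "\<not> k_connected 3 (path_graph n \<box> path_graph m)"
proof
  assume k: "k_connected 3 (path_graph n \<box> path_graph m)"
  have "card {(1::nat, 0::nat), (0, 1)} < 3" by (simp add: card_insert_if)
  then obtain w where "((0, 0), w) \<in> parcs (path_graph n \<box> path_graph m)" "w \<notin> {(1, 0), (0, 1)}"
    using k_connected_min_degree[OF pair_graph_cart_prod k, of "(0, 0)" "{(1, 0), (0, 1)}"] assms
      pair_graph_path_graph by (auto simp: path_graph_def)
  then show False by (cases w) (auto simp: path_graph_def)
qed

section \<open>Connected graphs of maximum degree two\<close>

lemma verts_path_cycle_graph [simp]: "pverts (path_graph n) = {..<n}" "pverts (cycle_graph n) = {..<n}"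
  by (simp_all add: path_graph_def cycle_graph_def)

text \<open>A longest path is closed under adjacency: its ends by maximality, its inner vertices
  because their two neighbours on the path exhaust their degree. By connectivity it contains all
  vertices, and the only further edge possible joins its ends.\<close>

lemma max_degree_2_classification:
  assumes gr: "pair_graph G" and con: "connected_in (parcs G) (pverts G)"
    and deg: "\<And>v a b c. (v, a) \<in> parcs G \<Longrightarrow> (v, b) \<in> parcs G \<Longrightarrow> (v, c) \<in> parcs G \<Longrightarrow>
      distinct [a, b, c] \<Longrightarrow> False"
  shows "G \<simeq>\<^sub>G path_graph (card (pverts G)) \<or>
    card (pverts G) \<ge> 3 \<and> G \<simeq>\<^sub>G cycle_graph (card (pverts G))"
proof -
  let ?E = "parcs G" let ?V = "pverts G"
  let ?P = "\<lambda>xs. xs \<noteq> [] \<and> distinct xs \<and> set xs \<subseteq> ?V \<and> successively (\<lambda>u v. (u, v) \<in> ?E) xs"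
  have fin: "finite ?V" using gr by (rule pair_graph_finite)
  have E: "u \<in> ?V" "v \<in> ?V" "u \<noteq> v" "(v, u) \<in> ?E" if "(u, v) \<in> ?E" for u v
    using pair_graph_edge[OF gr that] by auto
  obtain v0 where "v0 \<in> ?V" using con by (auto simp: connected_in_def)
  then have "?P [v0]" by simp
  moreover have "\<forall>ys. ?P ys \<longrightarrow> length ys < Suc (card ?V)"
    using fin by (metis card_mono distinct_card le_imp_less_Suc)
  ultimately have "\<exists>xs. ?P xs \<and> (\<forall>ys. ?P ys \<longrightarrow> length ys \<le> length xs)"
    by (rule ex_has_greatest_nat)
  then obtain xs where "?P xs \<and> (\<forall>ys. ?P ys \<longrightarrow> length ys \<le> length xs)" ..
  then have xs: "?P xs" and longest: "\<And>ys. ?P ys \<Longrightarrow> length ys \<le> length xs" by auto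
  have succ: "(xs ! i, xs ! Suc i) \<in> ?E" if "Suc i < length xs" for i
    using xs that successively_nth by fast
  have ne: "xs ! i \<noteq> xs ! j" if "i < length xs" "j < length xs" "i \<noteq> j" for i j
    using xs that nth_eq_iff_index_eq by blast
  have hd_closed: "v \<in> set xs" if "(xs ! 0, v) \<in> ?E" for v
    using longest[of "v # xs"] xs E that by (auto simp: successively_Cons hd_conv_nth)
  have last_closed: "v \<in> set xs" if "(xs ! (length xs - 1), v) \<in> ?E" for v
    using longest[of "xs @ [v]"] xs E that by (auto simp: successively_append_iff last_conv_nth)
  have inner: "v = xs ! (i - 1) \<or> v = xs ! Suc i"
    if "0 < i" "Suc i < length xs" "(xs ! i, v) \<in> ?E" for i v
  proof (rule ccontr)
    assume a: "\<not> ?thesis"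
    have "(xs ! i, xs ! (i - 1)) \<in> ?E" using E(4)[OF succ[of "i - 1"]] that by simp
    moreover have "(xs ! i, xs ! Suc i) \<in> ?E" using succ that by simp
    moreover have "distinct [xs ! (i - 1), xs ! Suc i, v]"
      using a that ne[of "i - 1" "Suc i"] by auto
    ultimately show False using deg that(3) by blast
  qed
  have "v \<in> set xs" if u: "u \<in> set xs" and uv: "(u, v) \<in> ?E" for u v
  proof -
    obtain i where i: "i < length xs" "u = xs ! i" using u unfolding in_set_conv_nth by blast
    have "i = 0 \<or> i = length xs - 1 \<or> 0 < i \<and> Suc i < length xs" using i(1) by arith
    then consider "i = 0" | "i = length xs - 1" | "0 < i" "Suc i < length xs" by blast
    then show ?thesis
    proof cases
      case 3
      then show ?thesis using inner[of i v] i uv nth_mem[of "i - 1" xs] nth_mem[of "Suc i" xs] by auto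
    qed (use i uv hd_closed last_closed in auto)
  qed
  then have V: "set xs = ?V" using connected_in_closed[OF con, of "set xs"] xs by auto
  let ?n = "length xs"
  have n: "card ?V = ?n" using V xs by (metis distinct_card)
  have bij: "bij_betw ((!) xs) {..<?n} ?V" using xs V bij_betw_nth by blast
  have chord: "j = Suc i \<or> i = 0 \<and> j = ?n - 1" if "i < j" "j < ?n" "(xs ! i, xs ! j) \<in> ?E" for i j
  proof (rule ccontr)
    assume a: "\<not> ?thesis"
    then have i: "i = 0" using inner[of i "xs ! j"] that ne[of j "i - 1"] ne[of j "Suc i"] by auto
    then have "Suc j < ?n" using a that by auto
    then have "xs ! 0 = xs ! (j - 1) \<or> xs ! 0 = xs ! Suc j"
      using inner[of j "xs ! i"] that E(4) i by auto
    moreover have "0 < j - 1" "j - 1 < ?n" using a i that by auto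
    then have "xs ! 0 \<noteq> xs ! (j - 1)" by (intro ne) linarith+
    moreover have "xs ! 0 \<noteq> xs ! Suc j" using \<open>Suc j < ?n\<close> by (intro ne) linarith+
    ultimately show False by blast
  qed
  show ?thesis
  \<comment> \<open>For two vertices the edge between the ends is the path itself, so the cyclic
    case must also ask for three vertices.\<close>
  proof (cases "?n \<ge> 3 \<and> (xs ! 0, xs ! (?n - 1)) \<in> ?E")
    case True
    have [simp]: "Suc (?n - Suc 0) = ?n" using True by linarith
    have lt: "(i, j) \<in> parcs (cycle_graph ?n) \<longleftrightarrow> (xs ! i, xs ! j) \<in> ?E" if "i < j" "j < ?n" for i j
    proof
      assume "(i, j) \<in> parcs (cycle_graph ?n)"
      then have "j = Suc i \<or> i = 0 \<and> j = ?n - 1"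
        using that by (cases "Suc j = ?n") (auto simp: cycle_graph_def)
      then show "(xs ! i, xs ! j) \<in> ?E" using succ that True by auto
    next
      assume "(xs ! i, xs ! j) \<in> ?E"
      then have "j = Suc i \<or> i = 0 \<and> j = ?n - 1" using chord that by blast
      then show "(i, j) \<in> parcs (cycle_graph ?n)"
        using that True by (auto simp: cycle_graph_def)
    qed
    have "(i, j) \<in> parcs (cycle_graph ?n) \<longleftrightarrow> (xs ! i, xs ! j) \<in> ?E" if "i < ?n" "j < ?n" for i j
      using lt[of i j] lt[of j i] that pair_graph_edge[OF pair_graph_cycle_graph[of ?n]] E True
      by (metis linorder_less_linear)
    then have "cycle_graph ?n \<simeq>\<^sub>G G"
      using bij gr True pair_graph_cycle_graph by (intro graph_isoI) auto
    then show ?thesis using True n gr graph_iso_sym pair_graph_cycle_graph by metis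
  next
    case False
    have lt: "(i, j) \<in> parcs (path_graph ?n) \<longleftrightarrow> (xs ! i, xs ! j) \<in> ?E" if "i < j" "j < ?n" for i j
    proof
      assume "(i, j) \<in> parcs (path_graph ?n)"
      then show "(xs ! i, xs ! j) \<in> ?E" using succ that by (auto simp: path_graph_def)
    next
      assume e: "(xs ! i, xs ! j) \<in> ?E"
      have "j = Suc i" using chord[OF that e] False e that by (cases "?n \<ge> 3") auto
      then show "(i, j) \<in> parcs (path_graph ?n)" using that by (auto simp: path_graph_def)
    qed
    have "(i, j) \<in> parcs (path_graph ?n) \<longleftrightarrow> (xs ! i, xs ! j) \<in> ?E" if "i < ?n" "j < ?n" for i j
      using lt[of i j] lt[of j i] that pair_graph_edge[OF pair_graph_path_graph[of ?n]] E
      by (metis linorder_less_linear)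
    then have "path_graph ?n \<simeq>\<^sub>G G"
      using bij gr pair_graph_path_graph by (intro graph_isoI) auto
    then show ?thesis using n gr graph_iso_sym pair_graph_path_graph by metis
  qed
qed

section \<open>From a planar prism to an outerplanar base\<close>

lemma (in drawn_graph) star_nbhd_vertex:
  assumes "W \<subseteq> V" "v \<in> V - W"
  shows "p v \<notin> star_nbhd W"
  using assms inj_p by (auto simp: star_nbhd_def dest: inj_onD)

text \<open>The second copy of \<open>J\<close> is connected and lies in a single region of the drawing of the first copy;
  the rungs show that every vertex of the first copy is on the boundary of that region.\<close>

lemma outerplanar_of_planar_prism:
  assumes gr: "pair_graph K" "pair_graph J" and K: "(k0, k1) \<in> parcs K"
    and J: "connected_in (parcs J) (pverts J)" and pl: "planar (K \<box> J)"
  shows "outerplanar J"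
proof -
  obtain p A where d: "plane_drawing (K \<box> J) p A" using pl by (auto simp: planar_def)
  interpret D: drawn_graph "K \<box> J" p A
    using pair_graph_cart_prod[OF gr] d by (rule drawn_graph.intro)
  have k: "k0 \<in> pverts K" "k1 \<in> pverts K" "k0 \<noteq> k1" "(k1, k0) \<in> parcs K"
    using pair_graph_edge[OF gr(1) K] by auto
  let ?p = "\<lambda>v. p (k0, v)" and ?A = "\<lambda>e. A (Pair k0 ` e)"
  have E: "((k0, u), (k0, v)) \<in> D.E" "u \<in> pverts J" "v \<in> pverts J" if "(u, v) \<in> parcs J" for u v
    using pair_graph_edge[OF gr(2) that] that k by auto
  have dJ: "plane_drawing J ?p ?A"
  proof (rule plane_drawingI)
    show "inj_on ?p (pverts J)" using D.inj_p k by (auto simp: inj_on_def)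
  next
    fix u v assume uv: "(u, v) \<in> parcs J"
    show "\<exists>g. arc g \<and> pathstart g = ?p u \<and> pathfinish g = ?p v \<and> path_image g = ?A {u, v}"
      using D.edge_arc[OF E(1)[OF uv]] by (metis image_empty image_insert)
    show "?A {u, v} \<inter> ?p ` pverts J \<subseteq> {?p u, ?p v}"
      using D.edge_vertex[OF E(1)[OF uv]] k by auto
  next
    fix u v x y assume uv: "(u, v) \<in> parcs J" and xy: "(x, y) \<in> parcs J" and ne: "{u, v} \<noteq> {x, y}"
    show "?A {u, v} \<inter> ?A {x, y} \<subseteq> ?p ` pverts J"
    proof
      fix z assume z: "z \<in> ?A {u, v} \<inter> ?A {x, y}"
      have "{(k0, u), (k0, v)} \<noteq> {(k0, x), (k0, y)}" using ne by (auto simp: doubleton_eq_iff)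
      then obtain w where "w \<in> {(k0, u), (k0, v)}" "z = p w"
        using D.edges_meet[OF E(1)[OF uv] E(1)[OF xy]] z by (metis IntD1 IntD2 image_empty image_insert)
      then show "z \<in> ?p ` pverts J" using E[OF uv] by auto
    qed
  qed (rule gr(2))
  \<comment> \<open>The star of the second copy includes the rungs without their far ends, so its
    closure reaches the vertices of the first copy.\<close>
  let ?W = "Pair k1 ` pverts J" let ?X = "drawing_points J ?p ?A"
  have W: "?W \<subseteq> D.V" "connected_in D.E ?W"
    using k connected_in_image[OF J, of "Pair k1" D.E] by auto
  have "D.star_nbhd ?W \<inter> ?X = {}"
  proof -
    have "?p v \<notin> D.star_nbhd ?W" if "v \<in> pverts J" for v
      using D.star_nbhd_vertex[OF W(1), of "(k0, v)"] that k by auto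
    moreover have "D.star_nbhd ?W \<inter> ?A {u, v} = {}" if "(u, v) \<in> parcs J" for u v
      using D.star_nbhd_walk[OF W(1), of "[(k0, u), (k0, v)]"] E(1)[OF that] k by auto
    ultimately show ?thesis by (auto simp: drawing_points_def)
  qed
  then have N: "D.star_nbhd ?W \<subseteq> - ?X" by blast
  obtain v0 where v0: "v0 \<in> pverts J" using J by (auto simp: connected_in_def)
  define s where "s = p (k1, v0)"
  define R where "R = connected_component_set (- ?X) s"
  have "s \<in> D.star_nbhd ?W" using v0 by (auto simp: D.star_nbhd_def s_def)
  then have sub: "D.star_nbhd ?W \<subseteq> R" and s: "s \<in> - ?X"
    using N D.connected_star_nbhd[OF W] connected_component_maximal unfolding R_def by blast+
  have "R \<in> components (- ?X)" unfolding R_def using s by (rule componentsI)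
  moreover have "?p ` pverts J \<subseteq> frontier R"
  proof
    fix z assume "z \<in> ?p ` pverts J"
    then obtain v where v: "v \<in> pverts J" "z = ?p v" by auto
    have "((k1, v), (k0, v)) \<in> D.E" using k v by auto
    then have "z \<in> closure (D.star_nbhd ?W)" using D.star_nbhd_closure[OF W(1), of "(k1, v)" "(k0, v)"] v by auto
    then have "z \<in> closure R" using sub closure_mono by blast
    moreover have "z \<notin> R"
      using v connected_component_subset[of "- ?X" s] unfolding R_def by (auto simp: drawing_points_def)
    ultimately show "z \<in> frontier R" using interior_subset by (auto simp: frontier_def)
  qed
  ultimately show ?thesis unfolding outerplanar_def using dJ by blast
qed

section \<open>Outerplanar graphs\<close>

text \<open>When the next vertex already occurs, the path is cut back to it and stays
  simple.\<close>

lemma simple_path_of_rtrancl: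
  assumes "(u, v) \<in> (E \<inter> W \<times> W)\<^sup>*" "u \<in> W"
  obtains xs where "xs \<noteq> []" "hd xs = u" "last xs = v" "distinct xs"
    "successively (\<lambda>u v. (u, v) \<in> E) xs" "set xs \<subseteq> W"
proof -
  have "\<exists>xs. xs \<noteq> [] \<and> hd xs = u \<and> last xs = v \<and> distinct xs \<and>
    successively (\<lambda>u v. (u, v) \<in> E) xs \<and> set xs \<subseteq> W"
    using assms(1)
  proof induction
    case base
    then show ?case using assms(2) by (intro exI[of _ "[u]"]) simp
  next
    case (step y z)
    then obtain xs where xs: "xs \<noteq> []" "hd xs = u" "last xs = y" "distinct xs"
      "successively (\<lambda>u v. (u, v) \<in> E) xs" "set xs \<subseteq> W" by blast
    show ?case
    proof (cases "z \<in> set xs")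
      case True
      then obtain as bs where "xs = as @ z # bs" by (meson split_list)
      then show ?thesis
        using xs by (intro exI[of _ "as @ [z]"]) (auto simp: successively_append_iff hd_append)
    next
      case False
      then show ?thesis
        using xs step by (intro exI[of _ "xs @ [z]"]) (auto simp: successively_append_iff)
    qed
  qed
  then show ?thesis using that by blast
qed

lemma is_cycle_rotate:
  assumes "is_cycle E (xs @ ys)" "xs \<noteq> []" "ys \<noteq> []"
  shows "is_cycle E (ys @ xs)"
  using assms by (auto simp: is_cycle_def successively_append_iff)

text \<open>An ear attached to a longest cycle either lengthens it or completes it to three internally
  disjoint paths.\<close>

lemma hamiltonian_cycle:
  assumes gr: "pair_graph G" and k2: "k_connected 2 G"
    and no_theta: "\<And>a b xs ys zs. ipath (parcs G) a xs b \<Longrightarrow> ipath (parcs G) a ys b \<Longrightarrow>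
      ipath (parcs G) a zs b \<Longrightarrow> set xs \<inter> set ys = {} \<Longrightarrow> set xs \<inter> set zs = {} \<Longrightarrow>
      set ys \<inter> set zs = {} \<Longrightarrow> xs \<noteq> [] \<Longrightarrow> ys \<noteq> [] \<Longrightarrow> zs \<noteq> [] \<Longrightarrow> False"
  obtains c where "is_cycle (parcs G) c" "set c = pverts G"
proof -
  let ?E = "parcs G" let ?V = "pverts G"
  have fin: "finite ?V" using gr by (rule pair_graph_finite)
  have E: "u \<in> ?V" "v \<in> ?V" "u \<noteq> v" "(v, u) \<in> ?E" if "(u, v) \<in> ?E" for u v
    using pair_graph_edge[OF gr that] by auto
  have card: "2 < card ?V" and con: "\<And>S. S \<subseteq> ?V \<Longrightarrow> card S < 2 \<Longrightarrow> connected_in ?E (?V - S)"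
    using k2 k_connected_iff[OF gr] by auto
  have conV: "connected_in ?E ?V" using con[of "{}"] by simp
  let ?P = "\<lambda>c. is_cycle ?E c \<and> set c \<subseteq> ?V"
  obtain a where a: "a \<in> ?V" using card by fastforce
  moreover have "?V \<noteq> {a}" using card by auto
  ultimately obtain b where "(a, b) \<in> ?E" using connected_in_has_neighbor[OF conV] by blast
  \<comment> \<open>The degenerate cycle along one edge starts the maximisation, so no genuine cycle
    has to be found beforehand.\<close>
  then have "?P [a, b]" using E by (auto simp: is_cycle_def)
  moreover have "\<forall>c. ?P c \<longrightarrow> length c < Suc (card ?V)"
    using fin by (metis is_cycle_def card_mono distinct_card le_imp_less_Suc)
  ultimately have "\<exists>c. ?P c \<and> (\<forall>d. ?P d \<longrightarrow> length d \<le> length c)"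
    by (rule ex_has_greatest_nat)
  then obtain c where "?P c \<and> (\<forall>d. ?P d \<longrightarrow> length d \<le> length c)" ..
  then have c: "is_cycle ?E c" "set c \<subseteq> ?V" and longest: "\<And>d. ?P d \<Longrightarrow> length d \<le> length c" by auto
  have "set c = ?V"
  proof (rule ccontr)
    assume ne: "set c \<noteq> ?V"
    have "set c \<noteq> {}" using c(1) by (auto simp: is_cycle_def)
    then obtain u v where uv: "u \<in> set c" "(u, v) \<in> ?E" "v \<notin> set c"
      using connected_in_closed[OF conV c(2)] ne by blast
    obtain as bs where c_split: "c = as @ u # bs" using uv(1) by (meson split_list)
    \<comment> \<open>The cycle is rotated so that it starts at the foot \<open>u\<close> of the
      ear.\<close>
    define d where "d = u # bs @ as"
    have d: "is_cycle ?E d" "set d = set c" "length d = length c"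
      using c(1) is_cycle_rotate[of ?E as "u # bs"] unfolding d_def c_split
      by (cases "as = []"; auto)+
    then have "bs @ as \<noteq> []" unfolding is_cycle_def d_def by (cases "bs @ as") auto
    then obtain w' where w': "w' \<in> set (bs @ as)" by (cases "bs @ as") auto
    have dist: "distinct (u # bs @ as)" using d(1) by (simp add: is_cycle_def d_def)
    \<comment> \<open>Since \<open>u\<close> is not a cut vertex, \<open>v\<close> can be led back
      to the cycle without passing through \<open>u\<close>. Stopping at the first return
      \<open>w\<close> leaves the inner vertices \<open>ms\<close> of the ear off the cycle.\<close>
    have "connected_in ?E (?V - {u})" using con[of "{u}"] E[OF uv(2)] by simp
    moreover have vw': "v \<in> ?V - {u}" "w' \<in> ?V - {u}"
      using E[OF uv(2)] w' dist c d by (auto simp: d_def)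
    ultimately have "(v, w') \<in> (?E \<inter> (?V - {u}) \<times> (?V - {u}))\<^sup>*" by (simp add: connected_in_def)
    then obtain xs where xs: "xs \<noteq> []" "hd xs = v" "last xs = w'" "distinct xs"
      "successively (\<lambda>u v. (u, v) \<in> ?E) xs" "set xs \<subseteq> ?V - {u}"
      using simple_path_of_rtrancl vw'(1) by metis
    have "\<exists>x\<in>set xs. x \<in> set c"
      using xs(1,3) w' d by (intro bexI[of _ w']) (auto simp: d_def)
    then obtain ms w rest where ms: "xs = ms @ w # rest" "w \<in> set c" "\<forall>y\<in>set ms. y \<notin> set c"
      using split_list_first_prop[of xs "\<lambda>x. x \<in> set c"] by blast
    have ms_ne: "ms \<noteq> []" and hd_ms: "hd ms = v"
      using ms xs(2) uv(3) by (cases ms; auto)+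
    have w: "w \<in> set (bs @ as)" using ms xs(6) d by (auto simp: d_def)
    then obtain X Y where XY: "bs @ as = X @ w # Y" by (meson split_list)
    have dd: "d = u # X @ w # Y" unfolding d_def XY by simp
    have ms_path: "ipath ?E u ms w"
      using ms xs(4,5,6) uv ms_ne hd_ms
      by (auto simp: ipath_def successively_append_iff successively_Cons)
    have dis: "set ms \<inter> set d = {}" using ms(3) d(2) by auto
    have cyc: "distinct (u # X @ w # Y)" "successively (\<lambda>u v. (u, v) \<in> ?E) (u # X @ w # Y)"
      "(last (w # Y), u) \<in> ?E"
      using d(1) unfolding dd by (auto simp: is_cycle_def)
    have msV: "set ms \<subseteq> ?V" using ms(1) xs(6) by auto
    \<comment> \<open>\<open>X\<close> and \<open>Y\<close> are the inner vertices of the two ways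
      around the cycle between \<open>u\<close> and \<open>w\<close>. An empty one is a single edge,
      which the longer ear can replace; this includes the degenerate cycle of two vertices.\<close>
    consider "X = []" | "Y = []" | "X \<noteq> []" "Y \<noteq> []" by blast
    then show False
    proof cases
      case 1
      have "is_cycle ?E (u # ms @ w # Y)"
        using cyc 1 ms_path dis unfolding dd is_cycle_def
        by (auto simp: ipath_def successively_append_iff successively_Cons hd_append)
      then have "length (u # ms @ w # Y) \<le> length c"
        by (intro longest) (use msV c d dd in auto)
      then show False using d(3) dd 1 ms_ne by (cases ms) auto
    next
      case 2
      \<comment> \<open>The ear replaces the closing edge of the cycle, so it has to be run
        backwards, from \<open>w\<close> to \<open>u\<close>.\<close>
      have "successively (\<lambda>u v. (v, u) \<in> ?E) (ms @ [w])"
        using ms_path E(4) by (auto simp: ipath_def successively_Cons elim!: successively_mono)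
      then have "successively (\<lambda>u v. (u, v) \<in> ?E) (rev (ms @ [w]))" by (simp only: successively_rev)
      then have "successively (\<lambda>u v. (u, v) \<in> ?E) (w # rev ms)" by simp
      moreover have "(hd ms, u) \<in> ?E" using uv(2) hd_ms E(4) by simp
      ultimately have "is_cycle ?E (u # X @ w # rev ms)"
        using cyc 2 dis ms_path ms_ne unfolding dd is_cycle_def
        by (auto simp: ipath_def successively_append_iff successively_Cons last_rev hd_append hd_rev
            split: if_splits)
      then have "length (u # X @ w # rev ms) \<le> length c"
        by (intro longest) (use msV c d dd in auto)
      then show False using d(3) dd 2 ms_ne by (cases ms) auto
    next
      case 3
      have X: "ipath ?E u X w"
        using cyc by (auto simp: ipath_def successively_append_iff successively_Cons hd_append)
      have "successively (\<lambda>u v. (v, u) \<in> ?E) (w # Y @ [u])"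
        using cyc(2,3) E(4)
        by (auto simp: successively_append_iff successively_Cons split: if_splits elim!: successively_mono)
      then have "successively (\<lambda>u v. (u, v) \<in> ?E) (rev (w # Y @ [u]))" by (simp only: successively_rev)
      then have Y: "ipath ?E u (rev Y) w" using cyc(1) by (auto simp: ipath_def)
      show False
        using no_theta[OF X ms_path Y] dis cyc(1) 3 ms_ne dd by auto
    qed
  qed
  then show ?thesis using that c(1) by blast
qed

lemma walk_points_append:
  "walk_points A (xs @ [a] @ ys) = walk_points A (xs @ [a]) \<union> walk_points A (a # ys)"
proof (induction xs rule: induct_list012)
  case 1
  then show ?case by simp
next
  case (2 x)
  then show ?case by (simp add: walk_points_Cons2)
next
  case (3 x y zs)
  then show ?case by (simp add: walk_points_Cons2 Un_assoc)
qed

lemma walk_points_snoc2: "walk_points A (xs @ [a, b]) = walk_points A (xs @ [a]) \<union> A {a, b}"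
  using walk_points_append[of A xs a "[b]"] by simp

lemma walk_points_rev: "walk_points A (rev xs) = walk_points A xs"
proof (induction xs rule: induct_list012)
  case (3 x y zs)
  then show ?case
    using walk_points_snoc2[of A "rev zs" y x] by (auto simp: walk_points_Cons2 insert_commute)
qed (auto simp: walk_points_def)

text \<open>A connected set with two points has no isolated point, and removing finitely many points
  destroys no limit point. For an open chord this gives accumulation at its ends.\<close>

lemma arc_inner_closure:
  fixes g :: "real \<Rightarrow> 'a::metric_space"
  assumes "arc g"
  shows "path_image g \<subseteq> closure (path_image g - {pathstart g, pathfinish g})"
proof
  let ?F = "{pathstart g, pathfinish g}"
  fix z assume z: "z \<in> path_image g"
  have "path_image g \<noteq> {x}" for x
    using arc_distinct_ends[OF assms]
    by (metis pathfinish_in_path_image pathstart_in_path_image singletonD)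
  then have "z islimpt path_image g"
    using assms z by (intro connected_imp_perfect[of "path_image g"])
      (simp_all add: arc_imp_path connected_path_image)
  moreover have "path_image g = ?F \<union> (path_image g - ?F)"
    by (auto simp: pathfinish_in_path_image pathstart_in_path_image)
  ultimately have "z islimpt ?F \<union> (path_image g - ?F)" by simp
  then have "z islimpt (path_image g - ?F)" by (subst (asm) islimpt_Un_finite) simp_all
  then show "z \<in> closure (path_image g - ?F)" by (simp add: closure_def)
qed

section \<open>Cycles with chords in a drawing\<close>

context drawn_graph
begin

definition cycle_points :: "'a list \<Rightarrow> complex set" where
  "cycle_points c = walk_points A (c @ [hd c])"

text \<open>The vertices \<open>a\<close> and \<open>b\<close> cut the cycle into two paths. The
  second runs from \<open>a\<close> backwards through \<open>P\<close>, over the closing edge and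
  backwards through \<open>Q\<close>, whence the list \<open>rev P @ rev Q\<close>.\<close>

lemma cycle_arcs:
  assumes c: "is_cycle E (P @ a # X @ b # Q)"
  shows "ipath E a X b" "P @ Q \<noteq> [] \<Longrightarrow> ipath E a (rev P @ rev Q) b"
    "cycle_points (P @ a # X @ b # Q) =
       walk_points A (a # X @ [b]) \<union> walk_points A (a # (rev P @ rev Q) @ [b])"
proof -
  have d: "distinct (P @ a # X @ b # Q)" and s: "successively (\<lambda>u v. (u, v) \<in> E) (P @ a # X @ b # Q)"
    and l: "(last (b # Q), hd (P @ [a])) \<in> E"
    using c by (auto simp: is_cycle_def hd_append split: if_splits)
  show "ipath E a X b"
    using d s by (auto simp: ipath_def successively_append_iff successively_Cons hd_append split: if_splits)
  have "successively (\<lambda>u v. (u, v) \<in> E) ((b # Q) @ (P @ [a]))"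
    using s l by (subst successively_append_iff) (auto simp: successively_append_iff successively_Cons hd_append)
  then have "successively (\<lambda>u v. (v, u) \<in> E) (b # Q @ P @ [a])"
    by (auto elim!: successively_mono simp: edge_sym)
  then have "successively (\<lambda>u v. (u, v) \<in> E) (rev (b # Q @ P @ [a]))" by (simp only: successively_rev)
  then show "ipath E a (rev P @ rev Q) b" using d by (auto simp: ipath_def)
  have "walk_points A (a # (rev P @ rev Q) @ [b]) = walk_points A (rev (b # Q @ P @ [a]))" by simp
  also have "\<dots> = walk_points A (b # Q @ P @ [a])" by (rule walk_points_rev)
  also have "\<dots> = walk_points A (b # Q @ [hd (P @ [a])]) \<union> walk_points A (P @ [a])"
    using walk_points_append[of A "b # Q" "hd P" "tl P @ [a]"] by (cases P) simp_all
  finally have "walk_points A (a # (rev P @ rev Q) @ [b]) = \<dots>" .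
  moreover have "cycle_points (P @ a # X @ b # Q) =
      walk_points A (P @ [a]) \<union> (walk_points A (a # X @ [b]) \<union> walk_points A (b # Q @ [hd (P @ [a])]))"
    using walk_points_append[of A P a "X @ b # Q @ [hd (P @ [a])]"]
      walk_points_append[of A "a # X" b "Q @ [hd (P @ [a])]"]
    by (auto simp: cycle_points_def hd_append)
  ultimately show "cycle_points (P @ a # X @ b # Q) =
       walk_points A (a # X @ [b]) \<union> walk_points A (a # (rev P @ rev Q) @ [b])" by auto
qed

text \<open>The chord is the middle arc of a theta curve whose outer arcs are the two parts of the
  cycle.\<close>

lemma chord_separated:
  assumes c: "is_cycle E (P @ a # X @ b # Q)" and ab: "(a, b) \<in> E"
    and S: "Topological_Spaces.connected S" "s \<in> S" "S \<inter> cycle_points (P @ a # X @ b # Q) = {}"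
      "S \<inter> A {a, b} = {}"
    and u: "u \<in> set X" "p u \<in> closure S" and v: "v \<in> set (P @ Q)" "p v \<in> closure S"
    and y: "y \<in> A {a, b} - {p a, p b}"
  shows "\<not> connected_component (- cycle_points (P @ a # X @ b # Q)) s y"
proof -
  have chord: "ipath E a [] b" using ab edge_verts by (auto simp: ipath_def)
  have ne: "P @ Q \<noteq> []" using v by (metis empty_iff empty_set)
  note arcs = cycle_arcs[OF c]
  have dis: "set X \<inter> set (rev P @ rev Q) = {}" using c by (auto simp: is_cycle_def)
  show ?thesis
    unfolding arcs(3)
    by (rule ipaths_separated[OF arcs(1) chord arcs(2)[OF ne] _ dis _ S(1,2) _ _ _ u(1,2) _ v(2)])
      (use S(3,4) v(1) y arcs(3) in auto)
qed

text \<open>A point \<open>r\<close> of the region, a point \<open>s\<close> of one chord and a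
  point \<open>t\<close> of the other are pairwise separated by the cycle, but a Jordan curve has
  only two sides.\<close>

lemma crossing_chords_impossible:
  assumes c: "is_cycle E c" "c = P @ a # X1 @ j # X2 @ b # Y @ d # Q"
    and ab: "(a, b) \<in> E" and jd: "(j, d) \<in> E"
    and R: "Topological_Spaces.connected R" "R \<inter> drawing_points G p A = {}" "p ` V \<subseteq> closure R"
  shows False
proof -
  let ?C = "cycle_points c"
  have c1: "c = P @ a # (X1 @ j # X2) @ b # (Y @ d # Q)"
    and c2: "c = (P @ a # X1) @ j # (X2 @ b # Y) @ d # Q" using c(2) by auto
  have dist: "distinct c" using c(1) by (simp add: is_cycle_def)
  have aV: "a \<in> V" "b \<in> V" "j \<in> V" "d \<in> V" using edge_verts ab jd by blast+
  note A1 = cycle_arcs[OF c(1)[unfolded c1], folded c1]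
  note A2 = cycle_arcs[OF c(1)[unfolded c2], folded c2]
  have A1b: "ipath E a (rev P @ rev (Y @ d # Q)) b" using A1(2) by simp
  have A2b: "ipath E j (rev (P @ a # X1) @ rev Q) d" using A2(2) by simp
  have walk_sub: "walk_points A (x # xs @ [y]) \<subseteq> drawing_points G p A" if ip: "ipath E x xs y" for x xs y
  proof
    fix z assume "z \<in> walk_points A (x # xs @ [y])"
    then obtain u v where "(u, v) \<in> E" "z \<in> A {u, v}" using ipath_edge[OF ip] by metis
    then show "z \<in> drawing_points G p A" unfolding drawing_points_def by blast
  qed
  have C_sub: "?C \<subseteq> drawing_points G p A"
    using walk_sub[OF A1(1)] walk_sub[OF A1b] A1(3) by auto
  have edge_sub: "A {x, y} \<subseteq> drawing_points G p A" if "(x, y) \<in> E" for x y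
    using that by (auto simp: drawing_points_def)
  have R_C: "R \<inter> ?C = {}" and R_ab: "R \<inter> A {a, b} = {}" and R_jd: "R \<inter> A {j, d} = {}"
    using R(2) C_sub edge_sub[OF ab] edge_sub[OF jd] by blast+
  have "V \<noteq> {}" using aV by auto
  then have "R \<noteq> {}" using R(3) by auto
  then obtain r where r: "r \<in> R" by blast
  obtain g where g: "arc g" "pathstart g = p a" "pathfinish g = p b" "path_image g = A {a, b}"
    using edge_arc[OF ab] .
  obtain h where h: "arc h" "pathstart h = p j" "pathfinish h = p d" "path_image h = A {j, d}"
    using edge_arc[OF jd] .
  obtain s where s: "s \<in> A {a, b} - {p a, p b}"
    using g arc_imp_simple_path nonempty_simple_path_endless by (metis all_not_in_conv)
  let ?S = "A {j, d} - {p j, p d}"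
  have S: "Topological_Spaces.connected ?S"
    using h arc_imp_simple_path connected_simple_path_endless by metis
  obtain t where t: "t \<in> ?S"
    using h arc_imp_simple_path nonempty_simple_path_endless by (metis all_not_in_conv)
  have S_cl: "p j \<in> closure ?S" "p d \<in> closure ?S"
    using arc_inner_closure[OF h(1)] h pathstart_in_path_image[of h] pathfinish_in_path_image[of h] by auto
  have chord_jd: "ipath E j [] d" and chord_ab: "ipath E a [] b"
    using ab jd edge_verts by (auto simp: ipath_def)
  have S_C: "?S \<inter> ?C = {}"
    using ipaths_meet[OF A2(1) chord_jd] ipaths_meet[OF A2b chord_jd] unfolding A2(3) by auto
  have s_C: "s \<notin> ?C"
    using ipaths_meet[OF A1(1) chord_ab] ipaths_meet[OF A1b chord_ab] s unfolding A1(3) by auto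
  have S_ab: "?S \<inter> A {a, b} = {}"
  proof (rule equals0I)
    fix z assume z: "z \<in> ?S \<inter> A {a, b}"
    have dif: "a \<noteq> j" "a \<noteq> d" "b \<noteq> j" "b \<noteq> d" using dist c(2) by auto
    then have "{a, b} \<noteq> {j, d}" by (simp add: doubleton_eq_iff)
    then obtain w where "w \<in> {a, b}" "w \<in> {j, d}" using edges_meet[OF ab jd] z by blast
    then show False using dif by auto
  qed
  have 1: "\<not> connected_component (- ?C) r s"
    using chord_separated[OF c(1)[unfolded c1] ab R(1) r, folded c1, of j d s] R_C R_ab R(3) aV s by auto
  have 2: "\<not> connected_component (- ?C) r t"
    using chord_separated[OF c(1)[unfolded c2] jd R(1) r, folded c2, of b a t] R_C R_jd R(3) aV t by auto
  \<comment> \<open>Here the open chord from \<open>j\<close> to \<open>d\<close> takes the place of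
    the region: it avoids the other chord and accumulates at \<open>j\<close> and \<open>d\<close>,
    which \<open>a\<close> and \<open>b\<close> separate on the cycle.\<close>
  have 3: "\<not> connected_component (- ?C) t s"
    using chord_separated[OF c(1)[unfolded c1] ab S t, folded c1, of j d s] S_C S_ab S_cl s by auto
  obtain g1 where g1: "arc g1" "pathstart g1 = p a" "pathfinish g1 = p b"
    "path_image g1 = walk_points A (a # (X1 @ j # X2) @ [b])" using ipath_arc[OF A1(1)] .
  obtain g2 where g2: "arc g2" "pathstart g2 = p a" "pathfinish g2 = p b"
    "path_image g2 = walk_points A (a # (rev P @ rev (Y @ d # Q)) @ [b])" using ipath_arc[OF A1b] .
  have "path_image g1 \<inter> path_image g2 = {p a, p b}"
    unfolding g1 g2 by (rule ipaths_meet[OF A1(1) A1b]) (use dist c(2) in auto)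
  then obtain q where q: "simple_path q" "pathfinish q = pathstart q" "path_image q = ?C"
    using simple_closed_curve_of_two_arcs[OF g1(1) g2(1) g1(2,3) g2(2,3)] g1(4) g2(4) A1(3) by metis
  have io: "Topological_Spaces.connected (inside ?C)" "Topological_Spaces.connected (outside ?C)"
    using Jordan_inside_outside[OF q(1,2)] unfolding q(3) by auto
  have same: "connected_component (- ?C) x y"
    if "x \<in> inside ?C \<and> y \<in> inside ?C \<or> x \<in> outside ?C \<and> y \<in> outside ?C" for x y
    using that io inside_no_overlap[of ?C] outside_no_overlap[of ?C]
    unfolding connected_component_def by blast
  have "z \<in> inside ?C \<or> z \<in> outside ?C" if "z \<notin> ?C" for z
    using insideI_not_outside[OF that] by blast
  then have "r \<in> inside ?C \<or> r \<in> outside ?C" "s \<in> inside ?C \<or> s \<in> outside ?C"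
    "t \<in> inside ?C \<or> t \<in> outside ?C" using r s_C t R_C S_C by blast+
  then show False using 1 2 3 same by blast
qed

end

text \<open>The region touches every vertex, so three internally disjoint paths with inner vertices
  contradict \<open>no_three_ipaths\<close>; this supplies the hypothesis of
  \<open>hamiltonian_cycle\<close>. Numbering the vertices along the resulting cycle turns
  alternating edges into crossing chords.\<close>

lemma outerplanar_vertex_order:
  assumes gr: "pair_graph J" and k2: "k_connected 2 J" and op: "outerplanar J"
  obtains f where "bij_betw f {..<card (pverts J)} (pverts J)"
    "\<And>i j k l. i < j \<Longrightarrow> j < k \<Longrightarrow> k < l \<Longrightarrow> l < card (pverts J) \<Longrightarrow>
      (f i, f k) \<in> parcs J \<Longrightarrow> (f j, f l) \<in> parcs J \<Longrightarrow> False"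
proof -
  obtain p A R where d: "plane_drawing J p A" and R: "R \<in> components (- drawing_points J p A)"
    "p ` pverts J \<subseteq> frontier R" using op by (auto simp: outerplanar_def)
  interpret D: drawn_graph J p A using gr d by (rule drawn_graph.intro)
  have R_con: "Topological_Spaces.connected R" and R_dis: "R \<inter> drawing_points J p A = {}"
    and R_cl: "p ` pverts J \<subseteq> closure R"
    using R in_components_connected in_components_subset by (fastforce simp: frontier_def)+
  have walk_dis: "R \<inter> walk_points A (x # xs @ [y]) = {}" if "ipath D.E x xs y" for x xs y
  proof -
    have "z \<in> drawing_points J p A" if z: "z \<in> walk_points A (x # xs @ [y])" for z
    proof -
      obtain u v where "(u, v) \<in> D.E" "z \<in> A {u, v}"
        using D.ipath_edge[OF \<open>ipath D.E x xs y\<close> z] by metis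
      then show ?thesis unfolding drawing_points_def by blast
    qed
    then show ?thesis using R_dis by blast
  qed
  obtain c where c: "is_cycle D.E c" "set c = pverts J"
  proof (rule hamiltonian_cycle[OF gr k2])
    fix a b xs ys zs
    assume ips: "ipath D.E a xs b" "ipath D.E a ys b" "ipath D.E a zs b"
      "set xs \<inter> set ys = {}" "set xs \<inter> set zs = {}" "set ys \<inter> set zs = {}"
      and ne: "xs \<noteq> []" "ys \<noteq> []" "zs \<noteq> []"
    have "hd xs \<in> set xs" "hd ys \<in> set ys" "hd zs \<in> set zs" using ne by auto
    moreover from this have "p (hd xs) \<in> closure R" "p (hd ys) \<in> closure R" "p (hd zs) \<in> closure R"
      using R_cl D.ipath_verts[OF ips(1)] D.ipath_verts[OF ips(2)] D.ipath_verts[OF ips(3)]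
      by (auto simp: image_subset_iff)
    ultimately show False
      using D.no_three_ipaths[OF ips R_con walk_dis[OF ips(1)] walk_dis[OF ips(2)] walk_dis[OF ips(3)]]
      by blast
  qed blast
  have dist: "distinct c" using c(1) by (simp add: is_cycle_def)
  have len: "length c = card (pverts J)" using c(2) distinct_card[OF dist] by simp
  show ?thesis
  proof (rule that[of "(!) c"])
    show "bij_betw ((!) c) {..<card (pverts J)} (pverts J)"
      using bij_betw_nth[OF dist] c(2) len by simp
  next
    fix i j k l
    assume lt: "i < j" "j < k" "k < l" "l < card (pverts J)"
      and e: "(c ! i, c ! k) \<in> D.E" "(c ! j, c ! l) \<in> D.E"
    have split: "drop m c = take (n - m) (drop m c) @ c ! n # drop (Suc n) c" if "m \<le> n" "n < length c" for m n
      using id_take_nth_drop[of "n - m" "drop m c"] that by simp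
    have "c = take i c @ c ! i # drop (Suc i) c" using lt len by (intro id_take_nth_drop) simp
    then have "c = take i c @ c ! i # take (j - Suc i) (drop (Suc i) c) @ c ! j #
        take (k - Suc j) (drop (Suc j) c) @ c ! k # take (l - Suc k) (drop (Suc k) c) @ c ! l # drop (Suc l) c"
      using split[of "Suc i" j] split[of "Suc j" k] split[of "Suc k" l] lt len by simp
    then show False
      using D.crossing_chords_impossible[OF c(1) _ e R_con R_dis R_cl] by blast
  qed
qed

section \<open>Drawings of products\<close>

text \<open>\<open>D\<close> chooses one direction for each edge, so that arcs can be given by
  formulas in an ordered pair although a drawing indexes them by sets.\<close>

lemma planarI:
  fixes p :: "'a \<Rightarrow> complex"
  assumes gr: "pair_graph G" and inj: "inj_on p (pverts G)"
    and cover: "\<And>u v. (u, v) \<in> parcs G \<Longrightarrow> (u, v) \<in> D \<or> (v, u) \<in> D"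
    and asym: "\<And>u v. (u, v) \<in> D \<Longrightarrow> (v, u) \<notin> D"
    and arc: "\<And>u v. (u, v) \<in> D \<Longrightarrow>
      \<exists>g. arc g \<and> pathstart g = p u \<and> pathfinish g = p v \<and> path_image g = B u v"
    and vertex: "\<And>u v w. (u, v) \<in> D \<Longrightarrow> w \<in> pverts G \<Longrightarrow> p w \<in> B u v \<Longrightarrow> w = u \<or> w = v"
    and meet: "\<And>u v x y. (u, v) \<in> D \<Longrightarrow> (x, y) \<in> D \<Longrightarrow> (u, v) \<noteq> (x, y) \<Longrightarrow>
      B u v \<inter> B x y \<subseteq> p ` pverts G"
  shows "planar G"
proof -
  \<comment> \<open>By \<open>asym\<close> the union has exactly one member when \<open>e\<close>
    comes from a pair in \<open>D\<close>.\<close>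
  define A where "A e = (\<Union>(u, v) \<in> {(u, v) \<in> D. {u, v} = e}. B u v)" for e
  have A: "A {u, v} = B u v" "A {v, u} = B u v" if "(u, v) \<in> D" for u v
  proof -
    have "{(x, y) \<in> D. {x, y} = {u, v}} = {(u, v)}"
      using that asym[OF that] by (auto simp: doubleton_eq_iff)
    then show "A {u, v} = B u v" by (simp add: A_def)
    then show "A {v, u} = B u v" by (simp add: insert_commute)
  qed
  have "plane_drawing G p A"
  proof (rule plane_drawingI)
    fix u v assume uv: "(u, v) \<in> parcs G"
    consider "(u, v) \<in> D" | "(v, u) \<in> D" using cover[OF uv] by blast
    then show "\<exists>g. arc g \<and> pathstart g = p u \<and> pathfinish g = p v \<and> path_image g = A {u, v}"
    proof cases
      case 1
      then show ?thesis using arc A by simp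
    next
      case 2
      obtain g where g: "arc g" "pathstart g = p v" "pathfinish g = p u" "path_image g = B v u"
        using arc[OF 2] by blast
      then show ?thesis using A(2)[OF 2] by (intro exI[of _ "reversepath g"]) (simp add: arc_reversepath)
    qed
    from cover[OF uv] show "A {u, v} \<inter> p ` pverts G \<subseteq> {p u, p v}"
    proof
      assume "(u, v) \<in> D"
      then show ?thesis using A vertex by fastforce
    next
      assume "(v, u) \<in> D"
      then show ?thesis using A vertex by fastforce
    qed
  next
    fix u v x y assume uv: "(u, v) \<in> parcs G" and xy: "(x, y) \<in> parcs G" and ne: "{u, v} \<noteq> {x, y}"
    obtain u' v' where u': "(u', v') \<in> D" "{u', v'} = {u, v}" using cover[OF uv] by blast
    obtain x' y' where x': "(x', y') \<in> D" "{x', y'} = {x, y}" using cover[OF xy] by blast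
    have "(u', v') \<noteq> (x', y')" using ne u' x' by auto
    then have "A {u', v'} \<inter> A {x', y'} \<subseteq> p ` pverts G"
      unfolding A(1)[OF u'(1)] A(1)[OF x'(1)] by (rule meet[OF u'(1) x'(1)])
    then show "A {u, v} \<inter> A {x, y} \<subseteq> p ` pverts G" unfolding u'(2) x'(2) .
  qed (use inj gr in auto)
  then show ?thesis by (auto simp: planar_def)
qed

section \<open>Prisms drawn with parabolas\<close>

lemma arc_over_segment:
  fixes a d :: real
  assumes "d \<noteq> 0" "continuous_on {0..1} h"
  shows "arc (\<lambda>t. Complex (a + t * d) (h t))"
  using assms unfolding arc_def path_def
  by (auto simp: inj_on_def intro!: continuous_intros)

text \<open>Strictly between \<open>a\<close> and \<open>b\<close> both factors are positive, and
  widening the interval makes at least one of them strictly larger.\<close>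

lemma nested_parabolas_meet:
  fixes x :: real
  assumes "a \<le> x" "x \<le> b" "c \<le> a" "b \<le> d" "(x - a) * (b - x) = (x - c) * (d - x)"
  shows "x = a \<or> x = b \<or> a = c \<and> b = d"
proof (rule ccontr)
  assume "\<not> ?thesis"
  then have lt: "a < x" "x < b" and ne: "c < a \<or> b < d" using assms by auto
  from ne have "(x - a) * (b - x) < (x - c) * (d - x)"
  proof
    assume "c < a"
    then show ?thesis using lt assms by (intro mult_less_le_imp_less) auto
  next
    assume "b < d"
    then show ?thesis using lt assms by (intro mult_le_less_imp_less) auto
  qed
  then show False using assms(5) by simp
qed

text \<open>Intervals that do not interlace are nested or share at most an end point. If the inner
  one is from \<open>c\<close> to \<open>d\<close>, both parabolas vanish at the common point, which
  is then an end of the outer interval too.\<close>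

lemma parabolas_meet:
  fixes x :: real
  assumes "a < b" "c < d" "\<not> (a < c \<and> c < b \<and> b < d)" "\<not> (c < a \<and> a < d \<and> d < b)"
    and "a \<le> x" "x \<le> b" "c \<le> x" "x \<le> d" "(x - a) * (b - x) = (x - c) * (d - x)"
  shows "x = a \<or> x = b \<or> a = c \<and> b = d"
proof -
  consider "b \<le> c" | "d \<le> a" | "c \<le> a" "b \<le> d" | "a \<le> c" "d \<le> b" using assms(1-4) by linarith
  then show ?thesis
  proof cases
    case 3
    then show ?thesis using nested_parabolas_meet assms by blast
  next
    case 4
    then have "x = c \<or> x = d \<or> c = a \<and> d = b" using nested_parabolas_meet[of c x d a b] assms by simp
    then show ?thesis
    proof (elim disjE)
      assume "x = c"
      then have "(x - a) * (b - x) = 0" using assms by simp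
      then show ?thesis by auto
    next
      assume "x = d"
      then have "(x - a) * (b - x) = 0" using assms by simp
      then show ?thesis by auto
    qed auto
  qed (use assms in auto)
qed

text \<open>The vertices of each copy of \<open>J\<close> lie on a horizontal line in the given order, an edge between
  the positions \<open>a\<close> and \<open>b\<close> being drawn as the parabola \<open>(x - a) (b - x)\<close> over the line for the
  first copy and reflected below the line for the second copy. The rungs are vertical.\<close>

lemma planar_prism:
  fixes h :: "'b \<Rightarrow> real"
  assumes gr: "pair_graph K" "pair_graph J" and K: "pverts K = {k0, k1}" "k0 \<noteq> k1"
    and inj: "inj_on h (pverts J)"
    and noncrossing: "\<And>u v x y. (u, v) \<in> parcs J \<Longrightarrow> (x, y) \<in> parcs J \<Longrightarrow>
      h u < h x \<Longrightarrow> h x < h v \<Longrightarrow> h v < h y \<Longrightarrow> False"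
  shows "planar (K \<box> J)"
proof -
  \<comment> \<open>Heights are kept for the copy of \<open>k0\<close> and reflected at height -1/2
    for the copy of \<open>k1\<close>. The copies thus lie at heights \<ge> 0 and \<le> -1, and the
    strip between them is left to the rungs.\<close>
  define \<sigma> where "\<sigma> a y = (if a = k0 then y else - 1 - y)" for a and y :: real
  define p where "p = (\<lambda>(a, v). Complex (h v) (\<sigma> a 0))"
  define D where "D = {((a, u), (a, v)) | a u v. a \<in> {k0, k1} \<and> (u, v) \<in> parcs J \<and> h u < h v} \<union>
    {((k0, u), (k1, u)) | u. u \<in> pverts J}"
  define B where "B = (\<lambda>(a, u) (b, v). if a = b
    then {Complex x (\<sigma> a ((x - h u) * (h v - x))) | x. h u \<le> x \<and> x \<le> h v}
    else {Complex (h u) t | t. - 1 \<le> t \<and> t \<le> 0})"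
  have E: "u \<in> pverts J" "v \<in> pverts J" "h u \<noteq> h v" "(v, u) \<in> parcs J" if "(u, v) \<in> parcs J" for u v
    using pair_graph_edge[OF gr(2) that] inj by (auto dest: inj_onD)
  have KE: "a = k0 \<and> b = k1 \<or> a = k1 \<and> b = k0" if "(a, b) \<in> parcs K" for a b
    using pair_graph_edge[OF gr(1) that] K by auto
  have hJ: "h u = h v \<longleftrightarrow> u = v" if "u \<in> pverts J" "v \<in> pverts J" for u v
    using inj that by (auto dest: inj_onD)
  have \<sigma>: "\<sigma> a y = \<sigma> b z \<longleftrightarrow> a = b \<and> y = z"
    if "a \<in> {k0, k1}" "b \<in> {k0, k1}" "0 \<le> y" "0 \<le> z" for a b y z
    using that K(2) by (auto simp: \<sigma>_def)
  \<comment> \<open>A parabola meets the closed strip of the rungs only where it vanishes, that is,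
    at its end vertices.\<close>
  have \<sigma>_rung: "y = 0" if "a \<in> {k0, k1}" "0 \<le> y" "- 1 \<le> \<sigma> a y" "\<sigma> a y \<le> 0" for a y
    using that by (auto simp: \<sigma>_def split: if_splits)
  have pos: "0 \<le> (x - a) * (b - x)" if "a \<le> x" "x \<le> b" for a b x :: real
    using that by simp
  show ?thesis
  proof (rule planarI[of _ p D B])
    show "pair_graph (K \<box> J)" using gr by (rule pair_graph_cart_prod)
    show "inj_on p (pverts (K \<box> J))"
      using K \<sigma>[of _ _ 0 0] hJ by (auto simp: inj_on_def p_def)
  next
    fix u v assume uv: "(u, v) \<in> parcs (K \<box> J)"
    obtain a x b y where ab: "u = (a, x)" "v = (b, y)" by (cases u; cases v)
    from uv consider "a = b" "a \<in> {k0, k1}" "(x, y) \<in> parcs J" | "(a, b) \<in> parcs K" "x = y" "x \<in> pverts J"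
      unfolding ab arcs_cart_prod K(1) by blast
    then show "(u, v) \<in> D \<or> (v, u) \<in> D"
    proof cases
      case 1
      then have "h x < h y \<or> h y < h x" using E(3) by fastforce
      then show ?thesis using 1 E(4) by (auto simp: D_def ab)
    next
      case 2
      then show ?thesis using KE[OF 2(1)] by (auto simp: D_def ab)
    qed
  next
    fix u v assume "(u, v) \<in> D"
    then show "(v, u) \<notin> D" using K(2) by (auto simp: D_def)
  next
    fix u v assume "(u, v) \<in> D"
    then consider a x y where "u = (a, x)" "v = (a, y)" "a \<in> {k0, k1}" "(x, y) \<in> parcs J" "h x < h y"
      | x where "u = (k0, x)" "v = (k1, x)" "x \<in> pverts J" by (auto simp: D_def)
    then show "\<exists>g. arc g \<and> pathstart g = p u \<and> pathfinish g = p v \<and> path_image g = B u v"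
    proof cases
      case 1
      define d where "d = h y - h x"
      have d: "d > 0" using 1 by (simp add: d_def)
      define g where "g t = Complex (h x + t * d) (\<sigma> a ((h x + t * d - h x) * (h y - (h x + t * d))))" for t
      have "continuous_on {0..1} (\<lambda>t. \<sigma> a ((h x + t * d - h x) * (h y - (h x + t * d))))"
        unfolding \<sigma>_def by (cases "a = k0") (auto intro!: continuous_intros)
      then have "arc g" unfolding g_def using d by (intro arc_over_segment) auto
      moreover have "path_image g = B u v"
      proof -
        have "(\<lambda>t. h x + t * d) ` {0..1} = {h x..h y}"
        proof
          show "(\<lambda>t. h x + t * d) ` {0..1} \<subseteq> {h x..h y}"
          proof clarify
            fix t :: real assume "t \<in> {0..1}"
            then have "0 \<le> t * d" "t * d \<le> 1 * d" using d by (auto intro: mult_right_mono)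
            then show "h x + t * d \<in> {h x..h y}" by (simp add: d_def)
          qed
          show "{h x..h y} \<subseteq> (\<lambda>t. h x + t * d) ` {0..1}"
          proof
            fix z assume "z \<in> {h x..h y}"
            then show "z \<in> (\<lambda>t. h x + t * d) ` {0..1}"
              using d by (intro image_eqI[of _ _ "(z - h x) / d"]) (auto simp: d_def field_simps)
          qed
        qed
        moreover have "path_image g =
          (\<lambda>z. Complex z (\<sigma> a ((z - h x) * (h y - z)))) ` ((\<lambda>t. h x + t * d) ` {0..1})"
          by (simp add: path_image_def g_def image_image)
        ultimately show ?thesis using 1 by (auto simp: B_def)
      qed
      ultimately show ?thesis
        using 1 by (intro exI[of _ g]) (auto simp: g_def pathstart_def pathfinish_def p_def d_def)
    next
      case 2
      let ?g = "linepath (Complex (h x) 0) (Complex (h x) (- 1))"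
      have "path_image ?g = B u v"
        using 2 K(2) by (auto simp: B_def closed_segment_same_Re closed_segment_eq_real_ivl complex_eq_iff
            intro!: exI[of _ "Im _"])
      then show ?thesis
        using 2 K(2) by (intro exI[of _ ?g]) (auto simp: p_def \<sigma>_def complex_eq_iff)
    qed
  next
    fix u v w assume uv: "(u, v) \<in> D" and w: "w \<in> pverts (K \<box> J)" and pw: "p w \<in> B u v"
    obtain c z where cz: "w = (c, z)" "c \<in> {k0, k1}" "z \<in> pverts J" using w K by (cases w) auto
    from uv consider a x y where "u = (a, x)" "v = (a, y)" "a \<in> {k0, k1}" "(x, y) \<in> parcs J" "h x < h y"
      | x where "u = (k0, x)" "v = (k1, x)" "x \<in> pverts J" by (auto simp: D_def)
    then show "w = u \<or> w = v"
    proof cases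
      case 1
      then have "\<sigma> c 0 = \<sigma> a ((h z - h x) * (h y - h z))" and le: "h x \<le> h z" "h z \<le> h y"
        using pw cz by (auto simp: B_def p_def)
      then have "c = a \<and> 0 = (h z - h x) * (h y - h z)"
        using \<sigma>[of c a 0] cz 1 pos[OF le] by blast
      then show ?thesis using hJ E[OF 1(4)] cz 1 by auto
    next
      case 2
      then show ?thesis using pw cz K(2) hJ by (auto simp: B_def p_def)
    qed
  next
    fix u v u' v' assume uv: "(u, v) \<in> D" and uv': "(u', v') \<in> D" and ne: "(u, v) \<noteq> (u', v')"
    have P: "Complex x (\<sigma> a 0) \<in> p ` pverts (K \<box> J)" if "a \<in> {k0, k1}" "v \<in> pverts J" "x = h v" for a v x
      using that K by (auto simp: p_def intro!: image_eqI[of _ _ "(a, v)"])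
    have mixed: "B (a, x) (a, y) \<inter> B (k0, z) (k1, z) \<subseteq> p ` pverts (K \<box> J)"
      if "a \<in> {k0, k1}" "(x, y) \<in> parcs J" "h x < h y" "z \<in> pverts J" for a x y z
    proof
      fix q assume q: "q \<in> B (a, x) (a, y) \<inter> B (k0, z) (k1, z)"
      then have q_eq: "q = Complex (h z) (\<sigma> a ((h z - h x) * (h y - h z)))" and le: "h x \<le> h z" "h z \<le> h y"
        and "- 1 \<le> Im q" "Im q \<le> 0" using K(2) by (auto simp: B_def)
      then have 0: "(h z - h x) * (h y - h z) = 0" using \<sigma>_rung[OF that(1) pos[OF le]] by simp
      show "q \<in> p ` pverts (K \<box> J)" using P[OF that(1,4) refl] unfolding q_eq 0 .
    qed
    from uv consider a x y where "u = (a, x)" "v = (a, y)" "a \<in> {k0, k1}" "(x, y) \<in> parcs J" "h x < h y"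
      | x where "u = (k0, x)" "v = (k1, x)" "x \<in> pverts J" by (auto simp: D_def)
    then show "B u v \<inter> B u' v' \<subseteq> p ` pverts (K \<box> J)"
    proof cases
      case 1
      from uv' consider a' x' y' where "u' = (a', x')" "v' = (a', y')" "a' \<in> {k0, k1}"
        "(x', y') \<in> parcs J" "h x' < h y'"
        | x' where "u' = (k0, x')" "v' = (k1, x')" "x' \<in> pverts J" by (auto simp: D_def)
      then show ?thesis
      proof cases
        case inner: 1
        show ?thesis
        proof
          fix q assume "q \<in> B u v \<inter> B u' v'"
          then obtain z where q: "q = Complex z (\<sigma> a ((z - h x) * (h y - z)))"
            "\<sigma> a ((z - h x) * (h y - z)) = \<sigma> a' ((z - h x') * (h y' - z))"
            and le: "h x \<le> z" "z \<le> h y" "h x' \<le> z" "z \<le> h y'"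
            using 1 inner by (auto simp: B_def)
          then have eq: "a = a'" "(z - h x) * (h y - z) = (z - h x') * (h y' - z)"
            using \<sigma>[of a a'] 1 inner pos by blast+
          have "z = h x \<or> z = h y \<or> h x = h x' \<and> h y = h y'"
            by (rule parabolas_meet[OF 1(5) inner(5) _ _ le eq(2)])
              (use noncrossing[OF 1(4) inner(4)] noncrossing[OF inner(4) 1(4)] in blast)+
          moreover have "\<not> (h x = h x' \<and> h y = h y')"
            using ne 1 inner eq(1) hJ E[OF 1(4)] E[OF inner(4)] by auto
          ultimately consider "z = h x" | "z = h y" by blast
          then show "q \<in> p ` pverts (K \<box> J)"
            using q(1) P[OF 1(3)] E[OF 1(4)] by cases simp_all
        qed
      next
        case 2
        then show ?thesis using mixed[OF 1(3,4,5)] 1 by simp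
      qed
    next
      case 2
      from uv' consider a' x' y' where "u' = (a', x')" "v' = (a', y')" "a' \<in> {k0, k1}"
        "(x', y') \<in> parcs J" "h x' < h y'"
        | x' where "u' = (k0, x')" "v' = (k1, x')" "x' \<in> pverts J" by (auto simp: D_def)
      then show ?thesis
      proof cases
        case 1
        then show ?thesis using mixed[OF 1(3,4,5)] 2 by (simp add: Int_commute)
      next
        case inner: 2
        then have "h x \<noteq> h x'" using hJ ne 2 by auto
        then show ?thesis using 2 inner K(2) by (auto simp: B_def)
      qed
    qed
  qed
qed

text \<open>Equal angles make the parameters differ by \<open>m * k\<close> with an integer
  \<open>k\<close>. As both lie in the closed interval from 0 to \<open>m\<close>, apart from
  equality only the coincidence of its two ends remains.\<close>

lemma polar_eq_iff:
  fixes m r r' s s' :: real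
  assumes "m > 0" "r > 0" "r' > 0" "0 \<le> s" "s \<le> m" "0 \<le> s'" "s' \<le> m"
    and "of_real r * cis (2 * pi * s / m) = of_real r' * cis (2 * pi * s' / m)"
  shows "r = r'" "s = s' \<or> s = 0 \<and> s' = m \<or> s = m \<and> s' = 0"
proof -
  have "norm (of_real r * cis (2 * pi * s / m)) = norm (of_real r' * cis (2 * pi * s' / m))"
    using assms(8) by simp
  then show r: "r = r'" using assms(2,3) by (simp add: norm_mult)
  then have "cis (2 * pi * s / m) = cis (2 * pi * s' / m)" using assms by simp
  then have "sin (2 * pi * s / m) = sin (2 * pi * s' / m) \<and> cos (2 * pi * s / m) = cos (2 * pi * s' / m)"
    by (simp add: complex_eq_iff)
  then obtain k :: int where "2 * pi * s / m = 2 * pi * s' / m + 2 * pi * of_int k"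
    using sin_cos_eq_iff by blast
  then have "2 * pi * s = 2 * pi * (s' + m * of_int k)" using assms(1) by (simp add: field_simps)
  then have k: "s = s' + m * of_int k" by simp
  have "\<bar>m * of_int k\<bar> \<le> m" using k assms by linarith
  then have "\<bar>of_int k :: real\<bar> \<le> 1" using assms(1) by (simp add: abs_mult)
  then have "k = 0 \<or> k = 1 \<or> k = - 1" by linarith
  then show "s = s' \<or> s = 0 \<and> s' = m \<or> s = m \<and> s' = 0" using k assms by auto
qed

text \<open>Concentric circles, one for each vertex of the path, joined by radial segments.\<close>

lemma planar_path_times_cycle:
  assumes m: "m \<ge> 3"
  shows "planar (path_graph n \<box> cycle_graph m)"
proof -
  define \<Phi> where "\<Phi> r s = of_real r * cis (2 * pi * s / real m)" for r s :: real
  \<comment> \<open>The radius \<open>i + 1\<close> keeps the innermost circle away from the origin,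
    where the angle is lost.\<close>
  define p where "p = (\<lambda>(i :: nat, j :: nat). \<Phi> (real i + 1) (real j))"
  define D where "D = {((i, j), (i, Suc j mod m)) | i j. i < n \<and> j < m} \<union>
    {((i, j), (Suc i, j)) | i j. Suc i < n \<and> j < m}"
  \<comment> \<open>The parameter runs on to \<open>j + 1\<close> without reduction modulo
    \<open>m\<close>. On the closing edge it ends at \<open>m\<close>, which \<open>wrap\<close>
    identifies with 0.\<close>
  define B where "B = (\<lambda>(i :: nat, j :: nat) (i' :: nat, j' :: nat). if i = i'
    then {\<Phi> (real i + 1) s | s. real j \<le> s \<and> s \<le> real j + 1}
    else {\<Phi> r (real j) | r. real i + 1 \<le> r \<and> r \<le> real i + 2})"
  let ?G = "path_graph n \<box> cycle_graph m"
  have V: "pverts ?G = {..<n} \<times> {..<m}" by (simp add: path_graph_def cycle_graph_def)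
  have eq: "r = r' \<and> (s = s' \<or> s = 0 \<and> s' = m \<or> s = m \<and> s' = 0)"
    if "\<Phi> r s = \<Phi> r' s'" "r > 0" "r' > 0" "0 \<le> s" "s \<le> m" "0 \<le> s'" "s' \<le> m" for r r' s s'
    using polar_eq_iff[of "real m" r r' s s'] that m unfolding \<Phi>_def by auto
  have wrap: "\<Phi> r (real m) = \<Phi> r 0" for r using m by (simp add: \<Phi>_def)
  have suc: "\<Phi> r (real j + 1) = \<Phi> r (real (Suc j mod m))" if "j < m" for r j
  proof (cases "Suc j = m")
    case True
    then have "real j + 1 = real m" by simp
    then show ?thesis using wrap[of r] True by (simp only: mod_self of_nat_0)
  next
    case False
    then show ?thesis using that by (simp add: add.commute)
  qed
  have P: "\<Phi> (real i + 1) (real j) \<in> p ` pverts ?G" if "i < n" "j < m" for i j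
    using that unfolding V by (intro image_eqI[of _ _ "(i, j)"]) (auto simp: p_def)
  have P': "\<Phi> r s \<in> p ` pverts ?G" if "r = real i + 1" "s = real j" "i < n" "j \<le> m" for i j r s
    using that P[of i j] P[of i 0] wrap m by (cases "j = m") auto
  have cont: "continuous_on X (\<lambda>t. \<Phi> (f t) (g t))" if "continuous_on X f" "continuous_on X g"
    for X :: "real set" and f g
    unfolding \<Phi>_def using that m by (auto intro!: continuous_intros continuous_on_cis)
  have D_cases: thesis
    if "(u, v) \<in> D" "\<And>i j. u = (i, j) \<Longrightarrow> v = (i, Suc j mod m) \<Longrightarrow> i < n \<Longrightarrow> j < m \<Longrightarrow> thesis"
      "\<And>i j. u = (i, j) \<Longrightarrow> v = (Suc i, j) \<Longrightarrow> Suc i < n \<Longrightarrow> j < m \<Longrightarrow> thesis" for u v thesis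
    using that unfolding D_def by blast
  have circ: "B (i, j) (i, j') = {\<Phi> (real i + 1) s | s. real j \<le> s \<and> s \<le> real j + 1}" for i j j'
    by (simp add: B_def)
  have rad: "B (i, j) (Suc i, j) = {\<Phi> r (real j) | r. real i + 1 \<le> r \<and> r \<le> real i + 2}" for i j
    by (simp add: B_def)
  have mixed: "B (i, j) (i, j'') \<inter> B (i', j') (Suc i', j') \<subseteq> p ` pverts ?G"
    if "i < n" "j < m" "j' < m" for i j i' j' j''
  proof
    fix z assume "z \<in> B (i, j) (i, j'') \<inter> B (i', j') (Suc i', j')"
    then obtain s r where z: "z = \<Phi> (real i + 1) s" "real j \<le> s" "s \<le> real j + 1"
      "z = \<Phi> r (real j')" "real i' + 1 \<le> r" unfolding circ rad by blast
    then have "real i + 1 = r" using eq[of "real i + 1" s r "real j'"] that by auto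
    then show "z \<in> p ` pverts ?G" using P[of i j'] z that by simp
  qed
  show ?thesis
  proof (rule planarI[of _ p D B])
    show "pair_graph ?G" using m by (intro pair_graph_cart_prod pair_graph_path_graph pair_graph_cycle_graph)
    show "inj_on p (pverts ?G)"
    proof (rule inj_onI, clarify)
      fix i j i' j' assume *: "(i, j) \<in> pverts ?G" "(i', j') \<in> pverts ?G" "p (i, j) = p (i', j')"
      then show "i = i' \<and> j = j'"
        using eq[of "real i + 1" "real j" "real i' + 1" "real j'"] unfolding V p_def by auto
    qed
  next
    fix u v assume "(u, v) \<in> parcs ?G"
    then show "(u, v) \<in> D \<or> (v, u) \<in> D"
      by (cases u; cases v) (auto simp: D_def path_graph_def cycle_graph_def)
  next
    fix u v assume "(u, v) \<in> D"
    \<comment> \<open>Two steps around a cycle with at least three vertices do not return to the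
      start, so no edge is listed in both directions.\<close>
    moreover have "Suc (Suc j mod m) mod m \<noteq> j" if "j < m" for j
      using that m by (cases "Suc j = m"; cases "Suc (Suc j) = m") auto
    ultimately show "(v, u) \<notin> D" by (auto simp: D_def)
  next
    fix u v assume "(u, v) \<in> D"
    then show "\<exists>g. arc g \<and> pathstart g = p u \<and> pathfinish g = p v \<and> path_image g = B u v"
    proof (rule D_cases)
      fix i j assume uv: "u = (i, j)" "v = (i, Suc j mod m)" "i < n" "j < m"
      define g where "g t = \<Phi> (real i + 1) (real j + t)" for t
      have "inj_on g {0..1}"
      proof (rule inj_onI)
        fix t t' assume "t \<in> {0..1}" "t' \<in> {0..1}" "g t = g t'"
        then show "t = t'"
          using eq[of "real i + 1" "real j + t" "real i + 1" "real j + t'"] uv m by (auto simp: g_def)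
      qed
      moreover have "continuous_on {0..1} g" unfolding g_def by (intro cont continuous_intros)
      ultimately have "arc g" by (simp add: arc_def path_def)
      moreover have "path_image g = B u v"
      proof -
        have "(\<lambda>t. real j + t) ` {0..1} = {real j..real j + 1}" by simp
        moreover have "path_image g = \<Phi> (real i + 1) ` (\<lambda>t. real j + t) ` {0..1}"
          unfolding path_image_def image_image by (intro image_cong) (simp_all add: g_def)
        ultimately show ?thesis unfolding uv circ by auto
      qed
      ultimately show ?thesis using suc[OF uv(4)] uv
        by (intro exI[of _ g]) (auto simp: g_def pathstart_def pathfinish_def p_def)
    next
      fix i j assume uv: "u = (i, j)" "v = (Suc i, j)" "Suc i < n" "j < m"
      define g where "g t = \<Phi> (real i + 1 + t) (real j)" for t
      have "inj_on g {0..1}"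
      proof (rule inj_onI)
        fix t t' assume "t \<in> {0..1}" "t' \<in> {0..1}" "g t = g t'"
        then show "t = t'"
          using eq[of "real i + 1 + t" "real j" "real i + 1 + t'" "real j"] uv by (auto simp: g_def)
      qed
      moreover have "continuous_on {0..1} g" unfolding g_def by (intro cont continuous_intros)
      ultimately have "arc g" by (simp add: arc_def path_def)
      moreover have "path_image g = B u v"
      proof -
        have "(\<lambda>t. real i + 1 + t) ` {0..1} = {real i + 1..real i + 1 + 1}" by simp
        moreover have "path_image g = (\<lambda>r. \<Phi> r (real j)) ` (\<lambda>t. real i + 1 + t) ` {0..1}"
          unfolding path_image_def image_image by (intro image_cong) (simp_all add: g_def)
        ultimately show ?thesis unfolding uv rad by auto
      qed
      ultimately show ?thesis using uv
        by (intro exI[of _ g]) (auto simp: g_def pathstart_def pathfinish_def p_def add.commute)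
    qed
  next
    fix u v w assume uv: "(u, v) \<in> D" and w: "w \<in> pverts ?G" and pw: "p w \<in> B u v"
    obtain k l where kl: "w = (k, l)" "k < n" "l < m" using w V by auto
    from uv show "w = u \<or> w = v"
    proof (rule D_cases)
      fix i j assume ij: "u = (i, j)" "v = (i, Suc j mod m)" "i < n" "j < m"
      then obtain s where s: "\<Phi> (real k + 1) (real l) = \<Phi> (real i + 1) s" "real j \<le> s" "s \<le> real j + 1"
        using pw kl by (auto simp: circ p_def)
      then have "k = i" and "real l = s \<or> l = 0 \<and> s = real m"
        using eq[of "real k + 1" "real l" "real i + 1" s] kl ij by auto
      moreover have "l = j \<or> l = Suc j mod m"
        using calculation(2)
      proof
        assume "real l = s"
        then have "l = j \<or> l = Suc j" using s by linarith
        then show ?thesis using kl by auto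
      next
        assume "l = 0 \<and> s = real m"
        then have "Suc j = m" using s ij by linarith
        then show ?thesis using \<open>l = 0 \<and> s = real m\<close> by simp
      qed
      ultimately show ?thesis using kl ij by auto
    next
      fix i j assume ij: "u = (i, j)" "v = (Suc i, j)" "Suc i < n" "j < m"
      then obtain r where r: "\<Phi> (real k + 1) (real l) = \<Phi> r (real j)" "real i + 1 \<le> r" "r \<le> real i + 2"
        using pw kl by (auto simp: rad p_def)
      then have "real k + 1 = r" "l = j"
        using eq[of "real k + 1" "real l" r "real j"] kl ij by auto
      moreover from this r have "k = i \<or> k = Suc i" by linarith
      ultimately show ?thesis using kl ij by auto
    qed
  next
    fix u v u' v' assume uv: "(u, v) \<in> D" and uv': "(u', v') \<in> D" and ne: "(u, v) \<noteq> (u', v')"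
    from uv show "B u v \<inter> B u' v' \<subseteq> p ` pverts ?G"
    proof (rule D_cases)
      fix i j assume ij: "u = (i, j)" "v = (i, Suc j mod m)" "i < n" "j < m"
      from uv' show ?thesis
      proof (rule D_cases)
        fix i' j' assume ij': "u' = (i', j')" "v' = (i', Suc j' mod m)" "i' < n" "j' < m"
        show ?thesis
        proof
          fix z assume "z \<in> B u v \<inter> B u' v'"
          then obtain s s' where z: "z = \<Phi> (real i + 1) s" "real j \<le> s" "s \<le> real j + 1"
            "z = \<Phi> (real i' + 1) s'" "real j' \<le> s'" "s' \<le> real j' + 1"
            unfolding ij ij' circ by blast
          then have *: "i = i'" "s = s' \<or> s = 0 \<and> s' = m \<or> s = m \<and> s' = 0"
            using eq[of "real i + 1" s "real i' + 1" s'] ij ij' by auto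
          then have "j \<noteq> j'" using ne ij ij' by auto
          \<comment> \<open>Two different unit intervals with integer ends share at most an end
            point; the other possibility is the wrap from \<open>m\<close> to 0.\<close>
          have "s = real j \<or> s = real (Suc j) \<or> s = real 0 \<or> s = real m"
            using *(2) \<open>j \<noteq> j'\<close> z by auto
          then show "z \<in> p ` pverts ?G"
            using z(1) ij P'[of "real i + 1" i s j] P'[of "real i + 1" i s "Suc j"]
              P'[of "real i + 1" i s 0] P'[of "real i + 1" i s m] by auto
        qed
      next
        fix i' j' assume ij': "u' = (i', j')" "v' = (Suc i', j')" "Suc i' < n" "j' < m"
        show ?thesis unfolding ij ij' by (rule mixed[OF ij(3,4) ij'(4)])
      qed
    next
      fix i j assume ij: "u = (i, j)" "v = (Suc i, j)" "Suc i < n" "j < m"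
      from uv' show ?thesis
      proof (rule D_cases)
        fix i' j' assume ij': "u' = (i', j')" "v' = (i', Suc j' mod m)" "i' < n" "j' < m"
        show ?thesis unfolding ij ij' by (subst Int_commute) (rule mixed[OF ij'(3,4) ij(4)])
      next
        fix i' j' assume ij': "u' = (i', j')" "v' = (Suc i', j')" "Suc i' < n" "j' < m"
        show ?thesis
        proof
          fix z assume "z \<in> B u v \<inter> B u' v'"
          then obtain r r' where z: "z = \<Phi> r (real j)" "real i + 1 \<le> r" "r \<le> real i + 2"
            "z = \<Phi> r' (real j')" "real i' + 1 \<le> r'" "r' \<le> real i' + 2"
            unfolding ij ij' rad by blast
          then have *: "r = r'" "j = j'"
            using eq[of r "real j" r' "real j'"] ij ij' by auto
          then have "i \<noteq> i'" using ne ij ij' by auto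
          then have "r = real i + 1 \<or> r = real (Suc i) + 1" using * z by auto
          then show "z \<in> p ` pverts ?G"
            using P[of i j] P[of "Suc i" j] z(1) ij by auto
        qed
      qed
    qed
  qed
qed

section \<open>The classification\<close>

text \<open>An edge uses only two vertices. By connectivity another edge leaves this pair and
  extends the first one at one of its ends.\<close>

lemma path_of_length_two:
  assumes gr: "pair_graph G" and con: "connected_in (parcs G) (pverts G)" and "card (pverts G) \<ge> 3"
  obtains x y z where "(x, y) \<in> parcs G" "(y, z) \<in> parcs G" "x \<noteq> z"
proof -
  obtain a where a: "a \<in> pverts G" using con by (auto simp: connected_in_def)
  have "pverts G \<noteq> {a}" using assms(3) by auto
  then obtain b where b: "(a, b) \<in> parcs G" "b \<in> pverts G"
    using connected_in_has_neighbor[OF con a] by blast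
  have "card {a, b} \<le> 2" by (simp add: card_insert_if)
  then have "{a, b} \<noteq> pverts G" using assms(3) by auto
  then obtain u v where uv: "u \<in> {a, b}" "(u, v) \<in> parcs G" "v \<notin> {a, b}"
    using connected_in_closed[OF con, of "{a, b}"] a b by blast
  moreover have "(b, a) \<in> parcs G" using pair_graph_edge[OF gr b(1)] by simp
  ultimately show ?thesis using that[of b a v] that[of a b v] b(1) by auto
qed

lemma connected_card_2_complete:
  assumes gr: "pair_graph K" and con: "connected_in (parcs K) (pverts K)" and K: "card (pverts K) = 2"
  shows "complete_digraph 2 (with_proj K)"
proof -
  obtain a b where ab: "pverts K = {a, b}" "a \<noteq> b" using K by (meson card_2_iff)
  then obtain c where "(a, c) \<in> parcs K" using connected_in_has_neighbor[OF con, of a] by auto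
  then have "(a, b) \<in> parcs K" "(b, a) \<in> parcs K" using pair_graph_edge[OF gr] ab by blast+
  moreover have "u \<in> {a, b} \<and> v \<in> {a, b} \<and> u \<noteq> v" if "(u, v) \<in> parcs K" for u v
    using pair_graph_edge(1-3)[OF gr that] ab by simp
  ultimately have "parcs K = {(u, v). (u, v) \<in> pverts K \<times> pverts K \<and> u \<noteq> v}"
    unfolding ab(1) by blast
  then show ?thesis
    using pair_graph_finite[OF gr] K by (simp add: complete_digraph_pair_def)
qed

lemma complete_2_connected:
  assumes K: "complete_digraph 2 (with_proj K)"
  obtains a b where "pverts K = {a, b}" "a \<noteq> b" "connected_in (parcs K) (pverts K)"
proof -
  have *: "card (pverts K) = 2" "parcs K = {(u, v). (u, v) \<in> pverts K \<times> pverts K \<and> u \<noteq> v}"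
    using K by (auto simp: complete_digraph_pair_def)
  then obtain a b where ab: "pverts K = {a, b}" "a \<noteq> b" by (meson card_2_iff)
  have "connected_in (parcs K) (set [a, b])"
    using * ab by (intro connected_in_successively) (auto simp: sym_def)
  then show ?thesis using that ab by simp
qed

lemma connected_path_graph:
  assumes "n > 0"
  shows "connected_in (parcs (path_graph n)) (pverts (path_graph n))"
proof -
  have "connected_in (parcs (path_graph n)) (set [0..<n])"
    using assms pair_graph_sym[OF pair_graph_path_graph]
    by (intro connected_in_successively) (auto simp: successively_conv_nth path_graph_def)
  then show ?thesis by (simp add: path_graph_def atLeast0LessThan)
qed

text \<open>Deleting one vertex opens the spanning cycle into a path through all the others.\<close>

lemma k_connected_2_cycle:
  assumes gr: "pair_graph G" and c: "is_cycle (parcs G) c" "set c = pverts G" "length c \<ge> 3"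
  shows "k_connected 2 G"
proof -
  have dist: "distinct c" using c(1) by (simp add: is_cycle_def)
  have "connected_in (parcs G) (pverts G - S)" if S: "S \<subseteq> pverts G" "card S < 2" for S
  proof -
    have "finite S" using S pair_graph_finite[OF gr] finite_subset by blast
    then consider "S = {}" | s where "S = {s}" using S(2) by (metis card_1_singletonE card_eq_0_iff less_2_cases One_nat_def)
    then show ?thesis
    proof cases
      case 1
      have "connected_in (parcs G) (set c)"
        using c pair_graph_sym[OF gr] by (intro connected_in_successively) (auto simp: is_cycle_def)
      then show ?thesis using 1 c by simp
    next
      case (2 s)
      then obtain as bs where split: "c = as @ s # bs" using S c by (metis insert_subset split_list)
      then have "connected_in (parcs G) (set (bs @ as))"
        using c pair_graph_sym[OF gr]
        by (intro connected_in_successively)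
          (auto simp: is_cycle_def successively_append_iff successively_Cons split: if_splits)
      moreover have "set (bs @ as) = pverts G - S" using 2 dist split unfolding c(2)[symmetric] by auto
      ultimately show ?thesis by simp
    qed
  qed
  moreover have "card (pverts G) = length c" using c(2) distinct_card[OF dist] by simp
  ultimately show ?thesis using c(3) k_connected_iff[OF gr] by auto
qed

lemma three_polytope_path_times_cycle:
  assumes "n \<ge> 2" "m \<ge> 3"
  shows "three_polytope (path_graph n \<box> cycle_graph m)"
proof -
  have "k_connected 2 (cycle_graph m)"
    using assms is_cycle_upt by (intro k_connected_2_cycle[of _ "[0..<m]"] pair_graph_cycle_graph) auto
  then show ?thesis
    unfolding three_polytope_def
    using assms connected_path_graph[of n]
    by (intro conjI pair_graph_cart_prod pair_graph_path_graph pair_graph_cycle_graph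
        planar_path_times_cycle k_connected_3_cart_prod) auto
qed

lemma three_polytope_outerplanar_prism:
  assumes K: "pair_graph K" "complete_digraph 2 (with_proj K)"
    and J: "pair_graph J" "outerplanar J" "k_connected 2 J"
  shows "three_polytope (K \<box> J)"
proof -
  obtain a b where ab: "pverts K = {a, b}" "a \<noteq> b" and con: "connected_in (parcs K) (pverts K)"
    using complete_2_connected[OF K(2)] .
  let ?n = "card (pverts J)"
  obtain f where f: "bij_betw f {..<?n} (pverts J)"
    "\<And>i j k l. i < j \<Longrightarrow> j < k \<Longrightarrow> k < l \<Longrightarrow> l < ?n \<Longrightarrow>
      (f i, f k) \<in> parcs J \<Longrightarrow> (f j, f l) \<in> parcs J \<Longrightarrow> False"
    using outerplanar_vertex_order[OF J(1,3,2)] by blast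
  \<comment> \<open>The position in the noncrossing order becomes the abscissa of a vertex in the
    drawing of the prism.\<close>
  define g where "g = inv_into {..<?n} f"
  have g: "bij_betw g (pverts J) {..<?n}" unfolding g_def using f(1) by (rule bij_betw_inv_into)
  have fg: "f (g v) = v" "g v < ?n" if "v \<in> pverts J" for v
    using that f(1) g by (auto simp: g_def bij_betw_def f_inv_into_f)
  have "planar (K \<box> J)"
  proof (rule planar_prism[OF K(1) J(1) ab, of "\<lambda>v. real (g v)"])
    show "inj_on (\<lambda>v. real (g v)) (pverts J)" using g by (auto simp: bij_betw_def inj_on_def)
    fix u v x y assume e: "(u, v) \<in> parcs J" "(x, y) \<in> parcs J"
      and lt: "real (g u) < real (g x)" "real (g x) < real (g v)" "real (g v) < real (g y)"
    have "u \<in> pverts J" "v \<in> pverts J" "x \<in> pverts J" "y \<in> pverts J"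
      using pair_graph_edge[OF J(1)] e by blast+
    then show False using f(2)[of "g u" "g x" "g v" "g y"] e lt by (simp add: fg)
  qed
  moreover have "k_connected 3 (K \<box> J)"
    using k_connected_3_cart_prod[OF K(1) J(1) con _ J(3)] ab by simp
  ultimately show ?thesis
    unfolding three_polytope_def using pair_graph_cart_prod[OF K(1) J(1)] by blast
qed

lemma no_claw_in_factor:
  assumes gr: "pair_graph H" "pair_graph J" and pl: "planar (H \<box> J)"
    and J: "connected_in (parcs J) (pverts J)" "card (pverts J) \<ge> 3"
    and "(v, a) \<in> parcs H" "(v, b) \<in> parcs H" "(v, c) \<in> parcs H" "distinct [a, b, c]"
  shows False
proof -
  obtain x y z where "(x, y) \<in> parcs J" "(y, z) \<in> parcs J" "x \<noteq> z"
    using path_of_length_two[OF gr(2) J] by blast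
  then show False using claw_times_path_not_planar[OF gr assms(6-9)] pl by blast
qed

text \<open>Commuting the factors transfers the degree bound from one to the other and turns a cycle
  times a path into a path times a cycle.\<close>

lemma factors_of_three_polytope:
  assumes gr: "pair_graph H" "pair_graph J" and P: "three_polytope (H \<box> J)"
    and ge3: "card (pverts H) \<ge> 3" "card (pverts J) \<ge> 3"
  obtains n m where "n \<ge> 2" "m \<ge> 3" "H \<box> J \<simeq>\<^sub>G path_graph n \<box> cycle_graph m"
proof -
  let ?h = "card (pverts H)" and ?j = "card (pverts J)"
  have pl: "planar (H \<box> J)" and k3: "k_connected 3 (H \<box> J)" using P by (auto simp: three_polytope_def)
  note prod = pair_graph_cart_prod
  have pl': "planar (J \<box> H)"
    using planar_iso[OF graph_iso_cart_prod_commute[OF gr(2,1)] prod[OF gr(2,1)] prod[OF gr] pl] .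
  note con = k_connected_cart_prod_factors[OF gr k3 zero_less_numeral]
  have H: "H \<simeq>\<^sub>G path_graph ?h \<or> H \<simeq>\<^sub>G cycle_graph ?h"
    using max_degree_2_classification[OF gr(1) con(1)] no_claw_in_factor[OF gr pl con(2) ge3(2)] by blast
  have J: "J \<simeq>\<^sub>G path_graph ?j \<or> J \<simeq>\<^sub>G cycle_graph ?j"
    using max_degree_2_classification[OF gr(2) con(2)] no_claw_in_factor[OF gr(2,1) pl' con(1) ge3(1)] by blast
  note [simp] = pair_graph_path_graph pair_graph_cycle_graph[OF ge3(1)] pair_graph_cycle_graph[OF ge3(2)]
    prod gr
  from H J consider "H \<simeq>\<^sub>G path_graph ?h" "J \<simeq>\<^sub>G path_graph ?j" | "H \<simeq>\<^sub>G cycle_graph ?h" "J \<simeq>\<^sub>G cycle_graph ?j"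
    | "H \<simeq>\<^sub>G path_graph ?h" "J \<simeq>\<^sub>G cycle_graph ?j" | "H \<simeq>\<^sub>G cycle_graph ?h" "J \<simeq>\<^sub>G path_graph ?j"
    by blast
  then show ?thesis
  proof cases
    case 1
    then have "H \<box> J \<simeq>\<^sub>G path_graph ?h \<box> path_graph ?j" by (rule graph_iso_cart_prod) simp_all
    then have "k_connected 3 (path_graph ?h \<box> path_graph ?j)"
      by (rule k_connected_iso) (use k3 in simp_all)
    then show ?thesis using path_graph_product_not_3_connected ge3 by simp
  next
    case 2
    then have "H \<box> J \<simeq>\<^sub>G cycle_graph ?h \<box> cycle_graph ?j" by (rule graph_iso_cart_prod) simp_all
    then have "cycle_graph ?h \<box> cycle_graph ?j \<simeq>\<^sub>G H \<box> J" by (rule graph_iso_sym) simp_all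
    then have "planar (cycle_graph ?h \<box> cycle_graph ?j)"
      by (rule planar_iso) (use pl in simp_all)
    then show ?thesis using cycle_graph_product_not_planar ge3 by blast
  next
    case 3
    then have "H \<box> J \<simeq>\<^sub>G path_graph ?h \<box> cycle_graph ?j" by (rule graph_iso_cart_prod) simp_all
    then show ?thesis using that[of ?h ?j] ge3 by linarith
  next
    case 4
    then have "J \<box> H \<simeq>\<^sub>G path_graph ?j \<box> cycle_graph ?h" by (intro graph_iso_cart_prod) simp_all
    with graph_iso_cart_prod_commute[OF gr] have "H \<box> J \<simeq>\<^sub>G path_graph ?j \<box> cycle_graph ?h"
      by (rule graph_iso_trans) simp_all
    then show ?thesis using that[of ?j ?h] ge3 by linarith
  qed
qed

lemma prism_factor_of_three_polytope:
  assumes gr: "pair_graph K" "pair_graph J" and P: "three_polytope (K \<box> J)"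
    and K: "card (pverts K) = 2" and J: "card (pverts J) \<ge> 2"
  shows "complete_digraph 2 (with_proj K)" "outerplanar J" "k_connected 2 J"
proof -
  have pl: "planar (K \<box> J)" and k3: "k_connected 3 (K \<box> J)" using P by (auto simp: three_polytope_def)
  note con = k_connected_cart_prod_factors[OF gr k3 zero_less_numeral]
  show "complete_digraph 2 (with_proj K)" using gr(1) con(1) K by (rule connected_card_2_complete)
  show "k_connected 2 J" using k_connected_2_of_prism gr K J k3 by blast
  obtain a b where "(a, b) \<in> parcs K"
  proof -
    obtain a where a: "a \<in> pverts K" using con by (auto simp: connected_in_def)
    have "pverts K \<noteq> {a}" using K by auto
    then show ?thesis using connected_in_has_neighbor[OF con(1) a] that by blast
  qed
  then show "outerplanar J" using outerplanar_of_planar_prism[OF gr _ _ pl] con by simp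
qed

text \<open>Two vertices per factor exclude the trivial product of \<open>G\<close> with a single
  vertex. Natural numbers as vertices of the factors are no restriction, since finite graphs can be
  relabelled. The two families on the right overlap in the prisms over polygons.\<close>

theorem proposition1p9:
  fixes G :: "'a pair_pre_digraph"
  assumes "pair_graph G"
  shows
    "(three_polytope G \<and>
      (\<exists>(H :: nat pair_pre_digraph) (J :: nat pair_pre_digraph).
         pair_graph H \<and> pair_graph J \<and> card (pverts H) \<ge> 2 \<and> card (pverts J) \<ge> 2 \<and> G \<simeq>\<^sub>G H \<box> J))
     \<longleftrightarrow>
     (\<exists>(K :: nat pair_pre_digraph) (J :: nat pair_pre_digraph).
         complete_digraph 2 (with_proj K) \<and> pair_graph J \<and> outerplanar J \<and> k_connected 2 J \<and>
         G \<simeq>\<^sub>G K \<box> J) \<or>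
     (\<exists>n m. n \<ge> 2 \<and> m \<ge> 3 \<and> G \<simeq>\<^sub>G path_graph n \<box> cycle_graph m)"
  (is "?L \<longleftrightarrow> ?prism \<or> ?cylinder")
proof
  assume ?L
  then obtain H J :: "nat pair_pre_digraph" where poly: "three_polytope G"
    and gr: "pair_graph H" "pair_graph J" and ge2: "card (pverts H) \<ge> 2" "card (pverts J) \<ge> 2"
    and iso: "G \<simeq>\<^sub>G H \<box> J" by blast
  note HJ = pair_graph_cart_prod[OF gr] and JH = pair_graph_cart_prod[OF gr(2,1)]
  have iso': "G \<simeq>\<^sub>G J \<box> H"
    using graph_iso_trans[OF iso graph_iso_cart_prod_commute[OF gr] assms HJ JH] .
  have P: "three_polytope (H \<box> J)" "three_polytope (J \<box> H)"
    using poly three_polytope_iso[OF iso assms HJ] three_polytope_iso[OF iso' assms JH] by auto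
  \<comment> \<open>A factor with exactly two vertices is connected and hence \<open>K_2\<close>. If
    it comes second, \<open>iso'\<close> moves it to the front.\<close>
  consider "card (pverts H) = 2" | "card (pverts J) = 2" | "card (pverts H) \<ge> 3" "card (pverts J) \<ge> 3"
    using ge2 by linarith
  then show "?prism \<or> ?cylinder"
  proof cases
    case 1
    then show ?thesis using prism_factor_of_three_polytope[OF gr P(1)] ge2 gr iso by blast
  next
    case 2
    then show ?thesis using prism_factor_of_three_polytope[OF gr(2,1) P(2)] ge2 gr iso' by blast
  next
    case 3
    then obtain n m where nm: "n \<ge> 2" "m \<ge> 3" "H \<box> J \<simeq>\<^sub>G path_graph n \<box> cycle_graph m"
      using factors_of_three_polytope[OF gr P(1)] by blast
    have "pair_graph (path_graph n \<box> cycle_graph m)"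
      using nm by (intro pair_graph_cart_prod pair_graph_path_graph pair_graph_cycle_graph)
    then show ?thesis using graph_iso_trans[OF iso nm(3) assms HJ] nm(1,2) by blast
  qed
next
  assume "?prism \<or> ?cylinder"
  then show ?L
  proof
    assume ?prism
    then obtain K J :: "nat pair_pre_digraph" where K: "complete_digraph 2 (with_proj K)"
      and J: "pair_graph J" "outerplanar J" "k_connected 2 J" and iso: "G \<simeq>\<^sub>G K \<box> J" by blast
    have Kg: "pair_graph K" using K by (rule pair_graphI_complete)
    have "card (pverts K) = 2" "card (pverts J) \<ge> 2"
      using K J(3) k_connected_iff[OF J(1)] by (auto simp: complete_digraph_pair_def)
    moreover have "three_polytope G"
      using three_polytope_iso[OF iso assms pair_graph_cart_prod[OF Kg J(1)]]
        three_polytope_outerplanar_prism[OF Kg K J] by simp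
    ultimately show ?L using Kg J(1) iso by (metis order_refl)
  next
    assume ?cylinder
    then obtain n m where nm: "n \<ge> 2" "m \<ge> 3" and iso: "G \<simeq>\<^sub>G path_graph n \<box> cycle_graph m" by blast
    note gr = pair_graph_path_graph[of n] pair_graph_cycle_graph[OF nm(2)]
    have "three_polytope G"
      using three_polytope_iso[OF iso assms pair_graph_cart_prod[OF gr]]
        three_polytope_path_times_cycle[OF nm] by simp
    moreover have "card (pverts (path_graph n)) \<ge> 2" "card (pverts (cycle_graph m)) \<ge> 2"
      using nm by (simp_all add: path_graph_def cycle_graph_def)
    ultimately show ?L using gr iso by blast
  qed
qed

end
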